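(* Let $k$ be a field of characteristic $0$. The generic symmetric quartic form in $n$ variables over $k$ has Waring rank at most $\binom{n+1}{2}+1=\binom{n+2}{2}-n$, and the generic symmetric quintic form in $n$ variables over $k$ has Waring rank at most $\binom{n+2}{2}$.
   Context: A form in $k[X_1,\dots,X_n]$ is symmetric if it is invariant under all permutations of the variables $X_1,\dots,X_n$. "Generic" refers to the forms in a nonempty Zariski open subset of the space of symmetric forms of the given degree. The Waring rank of a form $F$ of degree $m$ is the smallest $r$ such that $F$ can be written as $L_1^m+\cdots+L_r^m$ for linear forms $L_1,\dots,L_r$.
   Formalization: The Waring rank of a form over k is taken over an algebraically closed field containing k; with linear forms over k itself the quartic claim fails, e.g. for k = ℝ, n = 1, since aX⁴ with a < 0 is not a sum of fourth powers. *)

theory Defs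
  imports
    "HOL-Library.Poly_Mapping"
    "HOL-Library.Extended_Nat"
    "HOL-Combinatorics.Permutations"
    "HOL-Computational_Algebra.Polynomial"
begin

text \<open>
  A polynomial with indeterminates \<open>X\<^sub>v\<close>, \<open>v :: 'v\<close>, is a finitely supported map from monomials
  (exponent vectors) to coefficients. The ring structure is the convolution product on
  \<open>poly_mapping\<close>.
\<close>

type_synonym 'v monomial = "'v \<Rightarrow>\<^sub>0 nat"
type_synonym ('v, 'a) mpoly = "'v monomial \<Rightarrow>\<^sub>0 'a"

definition monomial_degree :: "'v monomial \<Rightarrow> nat" where
  "monomial_degree t = (\<Sum>v\<in>Poly_Mapping.keys t. Poly_Mapping.lookup t v)"

definition mpoly_eval :: "('v, 'a::comm_semiring_1) mpoly \<Rightarrow> ('v \<Rightarrow> 'a) \<Rightarrow> 'a" where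
  "mpoly_eval P x =
     (\<Sum>t\<in>Poly_Mapping.keys P. Poly_Mapping.lookup P t *
        (\<Prod>v\<in>Poly_Mapping.keys t. x v ^ Poly_Mapping.lookup t v))"

text \<open>Forms of degree \<open>m\<close> in \<open>X\<^sub>1, \<dots>, X\<^sub>n\<close>, including the zero form.\<close>

definition forms :: "nat \<Rightarrow> nat \<Rightarrow> (nat, 'a::zero) mpoly set" where
  "forms n m = {F. \<forall>t\<in>Poly_Mapping.keys F.
     Poly_Mapping.keys t \<subseteq> {1..n} \<and> monomial_degree t = m}"

text \<open>
  For a bijection \<open>\<pi>\<close> this is the substitution \<open>X\<^sub>i \<mapsto> X\<^bsub>\<pi>(i)\<^esub>\<close>: the coefficient of the result at
  an exponent vector \<open>t\<close> is the coefficient of \<open>F\<close> at \<open>t \<circ> \<pi>\<close>.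
\<close>

definition permute_vars :: "('v \<Rightarrow> 'v) \<Rightarrow> ('v, 'a::zero) mpoly \<Rightarrow> ('v, 'a) mpoly" where
  "permute_vars \<pi> F = Poly_Mapping.map_key (Poly_Mapping.map_key \<pi>) F"

definition symmetric_forms :: "nat \<Rightarrow> nat \<Rightarrow> (nat, 'a::zero) mpoly set" where
  "symmetric_forms n m = {F \<in> forms n m. \<forall>\<pi>. \<pi> permutes {1..n} \<longrightarrow> permute_vars \<pi> F = F}"

text \<open>
  Zariski open subsets of a linear space \<open>V\<close> of polynomials: complements in \<open>V\<close> of the common
  zero locus of a family of polynomials in the coefficients of \<open>F \<in> V\<close>. The indeterminates of
  these polynomials are indexed by the monomials of \<open>F\<close>.
\<close>

definition zariski_open_in ::
  "('v, 'a::comm_semiring_1) mpoly set \<Rightarrow> ('v, 'a) mpoly set \<Rightarrow> bool" where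
  "zariski_open_in V U \<longleftrightarrow>
     (\<exists>\<P> :: ('v monomial, 'a) mpoly set.
        U = V - {F \<in> V. \<forall>P\<in>\<P>. mpoly_eval P (Poly_Mapping.lookup F) = 0})"

definition generic_in ::
  "('v, 'a::comm_semiring_1) mpoly set \<Rightarrow> (('v, 'a) mpoly \<Rightarrow> bool) \<Rightarrow> bool" where
  "generic_in V Q \<longleftrightarrow> (\<exists>U. zariski_open_in V U \<and> U \<noteq> {} \<and> (\<forall>F\<in>U. Q F))"

text \<open>
  The value is \<open>\<infinity>\<close> if \<open>F\<close> is not a sum of \<open>m\<close>-th powers of linear forms with coefficients in the
  coefficient field of \<open>F\<close>.
\<close>

definition waring_rank :: "nat \<Rightarrow> nat \<Rightarrow> (nat, 'a::comm_semiring_1) mpoly \<Rightarrow> enat" where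
  "waring_rank n m F =
     (INF r \<in> {r. \<exists>L. (\<forall>i<r. L i \<in> forms n 1) \<and> F = (\<Sum>i<r. L i ^ m)}. enat r)"

text \<open>
  Extension of scalars along an embedding \<open>\<iota>\<close> of fields. Over a field that is not algebraically
  closed, the general symmetric form need not be a sum of powers of linear forms at all (such as
  \<open>-X\<^sub>1\<^sup>4\<close> over the reals), so ranks are taken after passing to an algebraically closed extension;
  for an algebraically closed field one can take \<open>\<iota> = id\<close>.
\<close>

definition extend_scalars :: "('a::zero \<Rightarrow> 'b::zero) \<Rightarrow> ('v, 'a) mpoly \<Rightarrow> ('v, 'b) mpoly" where
  "extend_scalars \<iota> F = Poly_Mapping.map \<iota> F"

definition field_embedding :: "('a::field \<Rightarrow> 'b::field) \<Rightarrow> bool" where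
  "field_embedding \<iota> \<longleftrightarrow> \<iota> 1 = 1 \<and>
     (\<forall>x y. \<iota> (x + y) = \<iota> x + \<iota> y) \<and> (\<forall>x y. \<iota> (x * y) = \<iota> x * \<iota> y)"

end

theory Submission
  imports Defs "HOL-Combinatorics.Multiset_Permutations"
begin

text \<open>
  A symmetric form of degree \<open>m\<close> corresponds to a coefficient tensor on \<open>{1..n}\<^sup>m\<close> that depends only on
  which of its indices coincide. It is therefore a combination of products of power sums: for quartics
  \<open>A p\<^sub>4 + 4 B p\<^sub>3 p\<^sub>1 + 3 C p\<^sub>2\<^sup>2 + 6 D p\<^sub>2 p\<^sub>1\<^sup>2 + E p\<^sub>1\<^sup>4\<close>, and for quintics
  \<open>A p\<^sub>5 + 5 B p\<^sub>4 p\<^sub>1 + 10 Q p\<^sub>3 p\<^sub>2 + 10 G p\<^sub>3 p\<^sub>1\<^sup>2 + 15 R p\<^sub>2\<^sup>2 p\<^sub>1 + 10 H p\<^sub>2 p\<^sub>1\<^sup>3 + E p\<^sub>1\<^sup>5\<close>.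
  Quartics are matched with
  \<open>\<Sum>\<^sub>i (a X\<^sub>i + b p\<^sub>1)\<^sup>4 + \<Sum>\<^bsub>i<j\<^esub> (c (X\<^sub>i + X\<^sub>j) + d p\<^sub>1)\<^sup>4 + (e p\<^sub>1)\<^sup>4\<close>, which has
  \<open>n + (n choose 2) + 1\<close> terms. Here \<open>C\<close> and \<open>A\<close> determine \<open>c\<^sup>4\<close> and \<open>a\<^sup>4\<close>, \<open>B\<close> determines \<open>b / a\<close> linearly
  in terms of \<open>d / c\<close>, \<open>D\<close> becomes a quadratic equation for \<open>d / c\<close>, and \<open>e\<close> absorbs \<open>E\<close>.
  Quintics need a second orbit \<open>\<Sum>\<^sub>i (a' X\<^sub>i + b' p\<^sub>1)\<^sup>5\<close>: \<open>Q\<close> and \<open>R\<close> determine \<open>c\<close> and \<open>d\<close>, and Sylvester's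
  method for binary cubics then finds the two orbits from \<open>A, B, G, H\<close>.
\<close>

section \<open>Polynomial functions of the coefficients\<close>

definition monomial_eval :: "'v monomial \<Rightarrow> ('v \<Rightarrow> 'a::comm_semiring_1) \<Rightarrow> 'a" where
  "monomial_eval t x = (\<Prod>v\<in>Poly_Mapping.keys t. x v ^ Poly_Mapping.lookup t v)"

lemma monomial_eval_superset:
  assumes "finite S" "Poly_Mapping.keys t \<subseteq> S"
  shows "monomial_eval t x = (\<Prod>v\<in>S. x v ^ Poly_Mapping.lookup t v)"
  unfolding monomial_eval_def
  by (rule prod.mono_neutral_left) (use assms in \<open>auto simp: in_keys_iff\<close>)

lemma monomial_eval_add: "monomial_eval (s + t) x = monomial_eval s x * monomial_eval t x"
proof -
  let ?S = "Poly_Mapping.keys s \<union> Poly_Mapping.keys t"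
  have "Poly_Mapping.keys (s + t) \<subseteq> ?S"
    by (rule keys_add)
  then show ?thesis
    by (simp add: monomial_eval_superset[of ?S] lookup_add power_add prod.distrib)
qed

text \<open>Cancellation in a sum can shrink \<open>keys\<close>, so evaluation is rewritten over a
  fixed finite superset, where absent monomials have coefficient 0.\<close>

lemma mpoly_eval_superset:
  assumes "finite S" "Poly_Mapping.keys P \<subseteq> S"
  shows "mpoly_eval P x = (\<Sum>t\<in>S. Poly_Mapping.lookup P t * monomial_eval t x)"
  unfolding mpoly_eval_def monomial_eval_def[symmetric]
  by (rule sum.mono_neutral_left) (use assms in \<open>auto simp: in_keys_iff\<close>)

lemma mpoly_eval_add: "mpoly_eval (P + Q) x = mpoly_eval P x + mpoly_eval Q x"
proof -
  let ?S = "Poly_Mapping.keys P \<union> Poly_Mapping.keys Q"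
  have "Poly_Mapping.keys (P + Q) \<subseteq> ?S"
    by (rule keys_add)
  then show ?thesis
    by (simp add: mpoly_eval_superset[of ?S] lookup_add distrib_right sum.distrib)
qed

lemma mpoly_eval_sum: "mpoly_eval (\<Sum>i\<in>I. P i) x = (\<Sum>i\<in>I. mpoly_eval (P i) x)"
proof (induction I rule: infinite_finite_induct)
  case (infinite A)
  then show ?case by (simp add: mpoly_eval_def)
next
  case empty
  then show ?case by (simp add: mpoly_eval_def)
qed (simp add: mpoly_eval_add)

lemma mpoly_eval_single:
  "mpoly_eval (Poly_Mapping.single t c) x = c * monomial_eval t x"
  by (simp add: mpoly_eval_superset[of "{t}"])

lemma sum_singles:
  "(\<Sum>t\<in>Poly_Mapping.keys P. Poly_Mapping.single t (Poly_Mapping.lookup P t)) = P"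
proof (rule poly_mapping_eqI)
  fix t
  show "Poly_Mapping.lookup
     (\<Sum>t\<in>Poly_Mapping.keys P. Poly_Mapping.single t (Poly_Mapping.lookup P t)) t =
     Poly_Mapping.lookup P t"
    by (simp add: lookup_sum lookup_single when_def in_keys_iff)
qed

text \<open>Both factors are expanded into single terms; multiplying two of these adds exponent
  vectors, and \<open>monomial_eval_add\<close> splits the evaluation again.\<close>

lemma mpoly_eval_mult: "mpoly_eval (P * Q) x = mpoly_eval P x * mpoly_eval Q x"
proof -
  have "P * Q = (\<Sum>s\<in>Poly_Mapping.keys P. \<Sum>t\<in>Poly_Mapping.keys Q.
     Poly_Mapping.single (s + t) (Poly_Mapping.lookup P s * Poly_Mapping.lookup Q t))"
    using sum_product[of "\<lambda>s. Poly_Mapping.single s (Poly_Mapping.lookup P s)" "Poly_Mapping.keys P"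
        "\<lambda>t. Poly_Mapping.single t (Poly_Mapping.lookup Q t)" "Poly_Mapping.keys Q"]
    by (simp only: sum_singles mult_single)
  then have "mpoly_eval (P * Q) x = (\<Sum>s\<in>Poly_Mapping.keys P. \<Sum>t\<in>Poly_Mapping.keys Q.
     (Poly_Mapping.lookup P s * monomial_eval s x) * (Poly_Mapping.lookup Q t * monomial_eval t x))"
    by (simp add: mpoly_eval_sum mpoly_eval_single monomial_eval_add ac_simps)
  also have "\<dots> = mpoly_eval P x * mpoly_eval Q x"
    by (simp add: sum_product mpoly_eval_def monomial_eval_def)
  finally show ?thesis .
qed

text \<open>Lets an open condition be written as an ordinary expression in the coefficients, with
  closure rules in place of an explicit element of the convolution ring.\<close>

definition polynomial_fun :: "(('v \<Rightarrow> 'a::comm_ring_1) \<Rightarrow> 'a) \<Rightarrow> bool" where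
  "polynomial_fun f \<longleftrightarrow> (\<exists>P. \<forall>x. mpoly_eval P x = f x)"

named_theorems polynomial_intros

lemma polynomial_fun_const [polynomial_intros]: "polynomial_fun (\<lambda>x. c)"
  unfolding polynomial_fun_def
  by (rule exI[of _ "Poly_Mapping.single 0 c"]) (simp add: mpoly_eval_single monomial_eval_def)

lemma polynomial_fun_var [polynomial_intros]: "polynomial_fun (\<lambda>x. x v)"
  unfolding polynomial_fun_def
  by (rule exI[of _ "Poly_Mapping.single (Poly_Mapping.single v 1) 1"])
    (simp add: mpoly_eval_single monomial_eval_def)

lemma polynomial_fun_add [polynomial_intros]:
  "polynomial_fun f \<Longrightarrow> polynomial_fun g \<Longrightarrow> polynomial_fun (\<lambda>x. f x + g x)"
  unfolding polynomial_fun_def by (metis mpoly_eval_add)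

lemma polynomial_fun_mult [polynomial_intros]:
  "polynomial_fun f \<Longrightarrow> polynomial_fun g \<Longrightarrow> polynomial_fun (\<lambda>x. f x * g x)"
  unfolding polynomial_fun_def by (metis mpoly_eval_mult)

lemma polynomial_fun_diff [polynomial_intros]:
  assumes "polynomial_fun f" "polynomial_fun g"
  shows "polynomial_fun (\<lambda>x. f x - g x)"
  using polynomial_fun_add[OF assms(1) polynomial_fun_mult[OF polynomial_fun_const assms(2)], of "- 1"]
  by simp

lemma polynomial_fun_power [polynomial_intros]:
  "polynomial_fun f \<Longrightarrow> polynomial_fun (\<lambda>x. f x ^ k)"
  by (induction k) (auto intro!: polynomial_intros)

text \<open>A single polynomial suffices: its nonvanishing locus is open, and the witness
  \<open>F\<close> makes it nonempty.\<close>

lemma generic_inI: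
  assumes "polynomial_fun f" "F \<in> V" "f (Poly_Mapping.lookup F) \<noteq> 0"
    and "\<And>F. F \<in> V \<Longrightarrow> f (Poly_Mapping.lookup F) \<noteq> 0 \<Longrightarrow> Q F"
  shows "generic_in V Q"
proof -
  obtain P where P: "\<And>x. mpoly_eval P x = f x"
    using assms(1) unfolding polynomial_fun_def by blast
  have "zariski_open_in V {F \<in> V. f (Poly_Mapping.lookup F) \<noteq> 0}"
    unfolding zariski_open_in_def by (rule exI[of _ "{P}"]) (auto simp: P)
  then show ?thesis
    unfolding generic_in_def using assms by blast
qed

section \<open>Forms and their coefficient tensors\<close>

definition tuples :: "nat \<Rightarrow> nat \<Rightarrow> nat list set" where
  "tuples n m = {xs. set xs \<subseteq> {1..n} \<and> length xs = m}"

definition word_monomial :: "nat list \<Rightarrow> nat monomial" where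
  "word_monomial xs = (\<Sum>x\<leftarrow>xs. Poly_Mapping.single x 1)"

text \<open>Coefficients are indexed by words, and words with the same commutative monomial are
  summed. Powers of linear forms can then be expanded without multinomial factors.\<close>

definition tensor_form :: "nat \<Rightarrow> nat \<Rightarrow> (nat list \<Rightarrow> 'a) \<Rightarrow> (nat, 'a::comm_ring_1) mpoly" where
  "tensor_form n m g = (\<Sum>xs\<in>tuples n m. Poly_Mapping.single (word_monomial xs) (g xs))"

definition linear_form :: "nat \<Rightarrow> (nat \<Rightarrow> 'a) \<Rightarrow> (nat, 'a::comm_ring_1) mpoly" where
  "linear_form n a = (\<Sum>i\<in>{1..n}. Poly_Mapping.single (Poly_Mapping.single i 1) (a i))"

lemma finite_tuples [simp]: "finite (tuples n m)"
  unfolding tuples_def by (rule finite_lists_length_eq) simp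

lemma tuples_0: "tuples n 0 = {[]}"
  by (auto simp: tuples_def)

lemma tuples_Suc: "tuples n (Suc m) = (\<lambda>(i, xs). i # xs) ` ({1..n} \<times> tuples n m)"
proof (intro equalityI subsetI)
  fix xs assume "xs \<in> tuples n (Suc m)"
  then show "xs \<in> (\<lambda>(i, xs). i # xs) ` ({1..n} \<times> tuples n m)"
    by (cases xs) (auto simp: tuples_def)
qed (auto simp: tuples_def)

lemma sum_tuples_Suc:
  "(\<Sum>xs\<in>tuples n (Suc m). f xs) = (\<Sum>i\<in>{1..n}. \<Sum>xs\<in>tuples n m. f (i # xs))"
proof -
  have "inj_on (\<lambda>(i, xs). i # xs) ({1..n} \<times> tuples n m)"
    by (auto simp: inj_on_def)
  then show ?thesis
    by (simp add: tuples_Suc sum.reindex sum.cartesian_product case_prod_unfold)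
qed

lemma word_monomial_Nil [simp]: "word_monomial [] = 0"
  by (simp add: word_monomial_def)

lemma word_monomial_Cons: "word_monomial (x # xs) = Poly_Mapping.single x 1 + word_monomial xs"
  by (simp add: word_monomial_def)

lemma lookup_word_monomial: "Poly_Mapping.lookup (word_monomial xs) v = count (mset xs) v"
  by (induction xs) (auto simp: word_monomial_Cons lookup_add lookup_single when_def)

lemma word_monomial_eq_iff: "word_monomial xs = word_monomial ys \<longleftrightarrow> mset xs = mset ys"
  by (metis lookup_word_monomial multiset_eqI poly_mapping_eqI)

lemma keys_word_monomial: "Poly_Mapping.keys (word_monomial xs) = set xs"
  by (auto simp: in_keys_iff lookup_word_monomial count_eq_zero_iff)

lemma degree_word_monomial: "monomial_degree (word_monomial xs) = length xs"
  using size_multiset_overloaded_eq[of "mset xs"]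
  by (simp add: monomial_degree_def keys_word_monomial lookup_word_monomial)

lemma word_monomial_surj: "\<exists>xs. word_monomial xs = t"
proof -
  define M where "M = (\<Sum>v\<in>Poly_Mapping.keys t. replicate_mset (Poly_Mapping.lookup t v) v)"
  have cnt: "count M v = Poly_Mapping.lookup t v" for v
    by (simp add: M_def count_sum in_keys_iff)
  obtain xs where xs: "mset xs = M"
    using ex_mset by blast
  have "word_monomial xs = t"
    by (rule poly_mapping_eqI) (simp add: lookup_word_monomial xs cnt)
  then show ?thesis by blast
qed

lemma word_monomial_surj_tuples:
  assumes "Poly_Mapping.keys t \<subseteq> {1..n}" "monomial_degree t = m"
  shows "\<exists>xs\<in>tuples n m. word_monomial xs = t"
proof -
  obtain xs where t: "word_monomial xs = t"
    using word_monomial_surj by blast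
  moreover have "xs \<in> tuples n m"
    using assms unfolding tuples_def t[symmetric]
    by (simp add: keys_word_monomial degree_word_monomial)
  ultimately show ?thesis by blast
qed

lemma lookup_tensor_form:
  "Poly_Mapping.lookup (tensor_form n m g) t = (\<Sum>xs | xs \<in> tuples n m \<and> word_monomial xs = t. g xs)"
  unfolding tensor_form_def lookup_sum lookup_single when_def
  by (subst sum.inter_filter[symmetric]) (auto simp: conj_commute)

lemma tensor_form_in_forms: "tensor_form n m g \<in> forms n m"
proof -
  have "Poly_Mapping.keys t \<subseteq> {1..n} \<and> monomial_degree t = m"
    if t: "t \<in> Poly_Mapping.keys (tensor_form n m g)" for t
  proof -
    have "{xs. xs \<in> tuples n m \<and> word_monomial xs = t} \<noteq> {}"
      using t unfolding in_keys_iff lookup_tensor_form by (metis sum.empty)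
    then obtain xs where xs: "xs \<in> tuples n m" "word_monomial xs = t" by blast
    show ?thesis
      using xs(1) by (simp add: xs(2)[symmetric] keys_word_monomial degree_word_monomial tuples_def)
  qed
  then show ?thesis unfolding forms_def by blast
qed

lemma tensor_form_cong:
  "(\<And>xs. xs \<in> tuples n m \<Longrightarrow> g xs = h xs) \<Longrightarrow> tensor_form n m g = tensor_form n m h"
  unfolding tensor_form_def by simp

lemma tensor_form_add:
  "tensor_form n m (\<lambda>xs. g xs + h xs) = tensor_form n m g + tensor_form n m h"
  unfolding tensor_form_def by (simp add: single_add sum.distrib)

lemma tensor_form_sum:
  "tensor_form n m (\<lambda>xs. \<Sum>j\<in>J. g j xs) = (\<Sum>j\<in>J. tensor_form n m (g j))"
proof (induction J rule: infinite_finite_induct)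
  case (insert j J)
  then show ?case by (simp add: tensor_form_add)
qed (simp_all add: tensor_form_def)

lemma extend_scalars_tensor_form:
  assumes "\<iota> 0 = 0" "\<And>x y. \<iota> (x + y) = \<iota> x + \<iota> y"
  shows "extend_scalars \<iota> (tensor_form n m g) = tensor_form n m (\<lambda>xs. \<iota> (g xs))"
proof (rule poly_mapping_eqI)
  fix t
  have hom: "\<iota> (\<Sum>x\<in>A. g x) = (\<Sum>x\<in>A. \<iota> (g x))" for A
    by (induction A rule: infinite_finite_induct) (simp_all add: assms)
  show "Poly_Mapping.lookup (extend_scalars \<iota> (tensor_form n m g)) t =
    Poly_Mapping.lookup (tensor_form n m (\<lambda>xs. \<iota> (g xs))) t"
    \<comment> \<open>\<open>Poly_Mapping.map\<close> keeps zero coefficients at zero whatever the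
      function is; \<open>\<iota> 0 = 0\<close> makes this agree with applying
      \<open>\<iota>\<close>.\<close>
    unfolding extend_scalars_def
    by (simp add: Poly_Mapping.map.rep_eq lookup_tensor_form hom when_def assms(1) flip: hom)
qed

lemma linear_form_in_forms: "linear_form n a \<in> forms n 1"
proof -
  have "linear_form n a = tensor_form n 1 (\<lambda>xs. a (hd xs))"
    unfolding linear_form_def tensor_form_def One_nat_def sum_tuples_Suc
    by (simp add: tuples_0 word_monomial_Cons)
  then show ?thesis by (simp add: tensor_form_in_forms)
qed

text \<open>Each further factor prepends a letter to every word, so the tensor of a power is the
  product of the coefficients of the letters.\<close>

lemma linear_form_power: "linear_form n a ^ m = tensor_form n m (\<lambda>xs. prod_list (map a xs))"
proof (induction m)
  case 0
  show ?case by (simp add: tensor_form_def tuples_0)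
next
  case (Suc m)
  have "linear_form n a ^ Suc m = linear_form n a * tensor_form n m (\<lambda>xs. prod_list (map a xs))"
    by (simp add: Suc)
  also have "\<dots> = tensor_form n (Suc m) (\<lambda>xs. prod_list (map a xs))"
    by (simp add: linear_form_def tensor_form_def sum_tuples_Suc sum_product mult_single
        word_monomial_Cons)
  finally show ?case .
qed

text \<open>Allows orbits of linear forms to be indexed by any finite set, such as a disjoint union
  of vertices and edges.\<close>

lemma waring_rank_sum_le:
  assumes "finite J" "\<And>j. j \<in> J \<Longrightarrow> L j \<in> forms n 1" "F = (\<Sum>j\<in>J. L j ^ m)"
  shows "waring_rank n m F \<le> enat (card J)"
proof -
  obtain \<phi> where \<phi>: "bij_betw \<phi> {0..<card J} J"
    using ex_bij_betw_nat_finite[OF assms(1)] by blast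
  have "F = (\<Sum>i<card J. L (\<phi> i) ^ m)"
    unfolding assms(3) lessThan_atLeast0 using sum.reindex_bij_betw[OF \<phi>, of "\<lambda>j. L j ^ m"] by simp
  moreover have "\<forall>i<card J. L (\<phi> i) \<in> forms n 1"
    using \<phi> assms(2) by (metis atLeastLessThan_iff bij_betw_apply zero_le)
  ultimately show ?thesis
    unfolding waring_rank_def by (intro INF_lower) (auto intro!: exI[of _ "\<lambda>i. L (\<phi> i)"])
qed

section \<open>Symmetric tensors and permutations of the variables\<close>

definition mset_invariant :: "('a list \<Rightarrow> 'b) \<Rightarrow> bool" where
  "mset_invariant g \<longleftrightarrow> (\<forall>xs ys. mset xs = mset ys \<longrightarrow> g xs = g ys)"

lemma mset_invariantD: "mset_invariant g \<Longrightarrow> mset xs = mset ys \<Longrightarrow> g xs = g ys"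
  unfolding mset_invariant_def by blast

text \<open>The polarization of \<open>F\<close>: each coefficient is spread evenly over the
  rearrangements of a word, whose number is invertible in characteristic 0.\<close>

definition form_tensor :: "(nat, 'a::field_char_0) mpoly \<Rightarrow> nat list \<Rightarrow> 'a" where
  "form_tensor F xs = Poly_Mapping.lookup F (word_monomial xs) /
     of_nat (card (permutations_of_multiset (mset xs)))"

lemma words_of_monomial:
  assumes "xs \<in> tuples n m"
  shows "{ys. ys \<in> tuples n m \<and> word_monomial ys = word_monomial xs} =
    permutations_of_multiset (mset xs)"
proof -
  have "ys \<in> tuples n m" if "mset ys = mset xs" for ys
    using assms mset_eq_setD[OF that] mset_eq_length[OF that] by (simp add: tuples_def)
  then show ?thesis
    unfolding permutations_of_multiset_def word_monomial_eq_iff by blast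
qed

lemma lookup_mset_invariant_tensor_form:
  assumes "mset_invariant g" "xs \<in> tuples n m"
  shows "Poly_Mapping.lookup (tensor_form n m g) (word_monomial xs) =
    of_nat (card (permutations_of_multiset (mset xs))) * g xs"
proof -
  have "g ys = g xs" if "ys \<in> permutations_of_multiset (mset xs)" for ys
    using assms(1) permutations_of_multisetD[OF that] unfolding mset_invariant_def by blast
  then show ?thesis
    by (simp add: lookup_tensor_form words_of_monomial[OF assms(2)])
qed

lemma form_tensor_tensor_form:
  assumes "mset_invariant g" "xs \<in> tuples n m"
  shows "form_tensor (tensor_form n m g) xs = g xs"
  by (simp add: form_tensor_def lookup_mset_invariant_tensor_form[OF assms])

lemma mset_invariant_form_tensor: "mset_invariant (form_tensor F)"
  unfolding mset_invariant_def form_tensor_def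
  by (metis word_monomial_eq_iff)

lemma tensor_form_form_tensor:
  assumes "F \<in> forms n m"
  shows "tensor_form n m (form_tensor F) = F"
proof (rule poly_mapping_eqI)
  fix t
  show "Poly_Mapping.lookup (tensor_form n m (form_tensor F)) t = Poly_Mapping.lookup F t"
  proof (cases "\<exists>xs\<in>tuples n m. word_monomial xs = t")
    case True
    then obtain xs where "xs \<in> tuples n m" "t = word_monomial xs" by blast
    then show ?thesis
      by (simp add: lookup_mset_invariant_tensor_form mset_invariant_form_tensor form_tensor_def)
  next
    case False
    then have "{xs. xs \<in> tuples n m \<and> word_monomial xs = t} = {}" by blast
    moreover have "Poly_Mapping.lookup F t = 0"
      using False assms word_monomial_surj_tuples unfolding forms_def
      by (metis (mono_tags, lifting) in_keys_iff mem_Collect_eq)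
    ultimately show ?thesis
      by (simp only: lookup_tensor_form sum.empty)
  qed
qed

lemma lookup_permute_vars:
  assumes "bij \<pi>"
  shows "Poly_Mapping.lookup (permute_vars \<pi> F) (word_monomial (map \<pi> xs)) =
    Poly_Mapping.lookup F (word_monomial xs)"
proof -
  have inj: "inj \<pi>" and surj: "surj \<pi>" using assms by (auto simp: bij_def)
  \<comment> \<open>\<open>map_key\<close> is composition only for an injective map, so the induced
    map on exponent vectors must be shown injective too.\<close>
  have "inj (Poly_Mapping.map_key \<pi> :: nat monomial \<Rightarrow> nat monomial)"
  proof (rule injI)
    fix s t :: "nat monomial"
    assume eq: "Poly_Mapping.map_key \<pi> s = Poly_Mapping.map_key \<pi> t"
    show "s = t"
    proof (rule poly_mapping_eqI)
      fix v
      obtain u where "v = \<pi> u" using surj by (rule surjE)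
      then show "Poly_Mapping.lookup s v = Poly_Mapping.lookup t v"
        using arg_cong[OF eq, of "\<lambda>s. Poly_Mapping.lookup s u"] by (simp add: map_key.rep_eq inj)
    qed
  qed
  moreover have "Poly_Mapping.map_key \<pi> (word_monomial (map \<pi> xs)) = word_monomial xs"
  proof (rule poly_mapping_eqI)
    fix v
    show "Poly_Mapping.lookup (Poly_Mapping.map_key \<pi> (word_monomial (map \<pi> xs))) v =
       Poly_Mapping.lookup (word_monomial xs) v"
      using inj by (simp add: map_key.rep_eq lookup_word_monomial count_mset count_list_map_conv del: mset_map)
  qed
  ultimately show ?thesis
    unfolding permute_vars_def by (simp add: map_key.rep_eq)
qed

lemma form_tensor_permutes:
  assumes "F \<in> symmetric_forms n m" "\<pi> permutes {1..n}"
  shows "form_tensor F (map \<pi> xs) = form_tensor F xs"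
proof -
  have "permute_vars \<pi> F = F"
    using assms unfolding symmetric_forms_def by blast
  then have "Poly_Mapping.lookup F (word_monomial (map \<pi> xs)) = Poly_Mapping.lookup F (word_monomial xs)"
    using lookup_permute_vars[OF permutes_bij[OF assms(2)], of F xs] by simp
  moreover have "card (permutations_of_multiset (mset (map \<pi> xs))) =
    card (permutations_of_multiset (mset xs))"
    using permutes_inj[OF assms(2)]
    by (simp add: permutations_of_multiset_image card_image inj_on_def)
  ultimately show ?thesis
    by (simp add: form_tensor_def)
qed

text \<open>\<open>\<pi>\<close> carries the words of a monomial bijectively onto the words of the
  permuted monomial, so the two coefficient sums agree term by term.\<close>

lemma tensor_form_symmetric:
  assumes perm: "\<And>\<pi> xs. \<pi> permutes {1..n} \<Longrightarrow> xs \<in> tuples n m \<Longrightarrow> g (map \<pi> xs) = g xs"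
  shows "tensor_form n m g \<in> symmetric_forms n m"
proof -
  let ?F = "tensor_form n m g"
  have "permute_vars \<pi> ?F = ?F" if \<pi>: "\<pi> permutes {1..n}" for \<pi>
  proof (rule poly_mapping_eqI)
    fix t
    obtain zs where zs: "t = word_monomial zs"
      using word_monomial_surj by metis
    define ys where "ys = map (inv \<pi>) zs"
    have zs_ys: "zs = map \<pi> ys"
      by (simp add: ys_def o_def permutes_inverses[OF \<pi>])
    let ?A = "\<lambda>ys. {xs. xs \<in> tuples n m \<and> word_monomial xs = word_monomial ys}"
    have inj: "inj \<pi>" by (rule permutes_inj[OF \<pi>])
    have map_tuples: "map \<sigma> xs \<in> tuples n m" if "\<sigma> permutes {1..n}" "xs \<in> tuples n m" for \<sigma> xs
      using that permutes_image[OF that(1)] by (force simp: tuples_def)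
    have "?A (map \<pi> ys) = map \<pi> ` ?A ys"
    proof (intro equalityI subsetI)
      fix xs assume xs: "xs \<in> ?A (map \<pi> ys)"
      have 1: "xs = map \<pi> (map (inv \<pi>) xs)"
        by (simp add: o_def permutes_inverses[OF \<pi>])
      have 2: "mset (map (inv \<pi>) xs) = mset ys"
      proof -
        have "mset xs = image_mset \<pi> (mset ys)"
          using xs by (simp add: word_monomial_eq_iff)
        then have "mset (map (inv \<pi>) xs) = image_mset (inv \<pi> \<circ> \<pi>) (mset ys)"
          by (simp add: multiset.map_comp)
        then show ?thesis using inj by simp
      qed
      have 3: "map (inv \<pi>) xs \<in> tuples n m"
        using xs map_tuples permutes_inv[OF \<pi>] by blast
      show "xs \<in> map \<pi> ` ?A ys"
        by (rule image_eqI[where f = "map \<pi>", OF 1]) (use 2 3 in \<open>simp only: word_monomial_eq_iff mem_Collect_eq\<close>)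
    next
      fix xs assume "xs \<in> map \<pi> ` ?A ys"
      then show "xs \<in> ?A (map \<pi> ys)"
        using map_tuples[OF \<pi>] by (auto simp: word_monomial_eq_iff)
    qed
    moreover have "inj_on (map \<pi>) (?A ys)"
      using inj by (simp add: inj_on_def inj_map_eq_map)
    ultimately have "Poly_Mapping.lookup ?F t = (\<Sum>xs\<in>?A ys. g (map \<pi> xs))"
      by (simp add: zs zs_ys lookup_tensor_form sum.reindex)
    also have "\<dots> = Poly_Mapping.lookup ?F (word_monomial ys)"
      unfolding lookup_tensor_form by (rule sum.cong) (use perm[OF \<pi>] in auto)
    also have "\<dots> = Poly_Mapping.lookup (permute_vars \<pi> ?F) t"
      by (simp add: zs zs_ys lookup_permute_vars[OF permutes_bij[OF \<pi>]])
    finally show "Poly_Mapping.lookup (permute_vars \<pi> ?F) t = Poly_Mapping.lookup ?F t" ..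
  qed
  then show ?thesis
    unfolding symmetric_forms_def using tensor_form_in_forms by blast
qed

section \<open>The orbits of linear forms\<close>

text \<open>For constant \<open>b\<close> these are the tensors of \<open>\<Sum>\<^sub>r (a X\<^sub>r + b p)\<^sup>m\<close> and
  \<open>\<Sum>\<^bsub>r<s\<^esub> (c (X\<^sub>r + X\<^sub>s) + d p)\<^sup>m\<close> with \<open>p = \<Sum> X\<^sub>i\<close>. Nonconstant \<open>b\<close> arises in the recursion for the latter.\<close>

definition vertex_tensor :: "nat \<Rightarrow> 'a::comm_ring_1 \<Rightarrow> (nat \<Rightarrow> 'a) \<Rightarrow> nat list \<Rightarrow> 'a" where
  "vertex_tensor n a b xs = (\<Sum>r\<in>{1..n}. prod_list (map (\<lambda>x. a * of_bool (x = r) + b x) xs))"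

text \<open>The edges of the complete graph on \<open>{1..n}\<close>.\<close>

definition edges :: "nat \<Rightarrow> nat set set" where
  "edges n = {S. S \<subseteq> {1..n} \<and> card S = 2}"

definition edge_tensor :: "nat \<Rightarrow> 'a::comm_ring_1 \<Rightarrow> 'a \<Rightarrow> nat list \<Rightarrow> 'a" where
  "edge_tensor n c d xs = (\<Sum>S\<in>edges n. prod_list (map (\<lambda>x. c * of_bool (x \<in> S) + d) xs))"

lemma finite_edges [simp]: "finite (edges n)"
  by (rule finite_subset[of _ "Pow {1..n}"]) (auto simp: edges_def)

lemma card_edges: "card (edges n) = n choose 2"
  using n_subsets[of "{1..n}" 2] by (simp add: edges_def)

lemma mset_invariant_prod_list:
  "mset_invariant (\<lambda>xs. prod_list (map f xs) :: 'a::comm_monoid_mult)"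
  unfolding mset_invariant_def by (metis mset_map prod_mset_prod_list)

lemma mset_invariant_sum:
  "(\<And>j. j \<in> J \<Longrightarrow> mset_invariant (g j)) \<Longrightarrow> mset_invariant (\<lambda>xs. \<Sum>j\<in>J. g j xs)"
  unfolding mset_invariant_def by (metis (mono_tags, lifting) sum.cong)

lemma mset_invariant_add:
  "mset_invariant g \<Longrightarrow> mset_invariant h \<Longrightarrow> mset_invariant (\<lambda>xs. g xs + h xs)"
  unfolding mset_invariant_def by metis

lemma mset_invariant_vertex: "mset_invariant (vertex_tensor n a b)"
  unfolding vertex_tensor_def by (intro mset_invariant_sum mset_invariant_prod_list)

lemma mset_invariant_edge: "mset_invariant (edge_tensor n c d)"
  unfolding edge_tensor_def by (intro mset_invariant_sum mset_invariant_prod_list)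

lemma vertex_tensor_Nil: "vertex_tensor n a b [] = of_nat n"
  by (simp add: vertex_tensor_def)

text \<open>In the factor of the first letter \<open>i\<close>, the \<open>a\<close> part survives
  only for \<open>r = i\<close>, while the \<open>b\<close> part does not depend on
  \<open>r\<close>. Unrolling this evaluates any concrete word.\<close>

lemma vertex_tensor_Cons:
  assumes "i \<in> {1..n}"
  shows "vertex_tensor n a b (i # xs) =
    a * prod_list (map (\<lambda>x. a * of_bool (x = i) + b x) xs) + b i * vertex_tensor n a b xs"
proof -
  have "(a * of_bool (i = r) + b i) * p = (if i = r then a * p else 0) + b i * p" for r p
    by (simp add: distrib_right)
  then have "vertex_tensor n a b (i # xs) =
    (\<Sum>r\<in>{1..n}. if i = r then a * prod_list (map (\<lambda>x. a * of_bool (x = r) + b x) xs) else 0)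
     + b i * vertex_tensor n a b xs"
    by (simp only: vertex_tensor_def list.map prod_list.Cons sum.distrib sum_distrib_left)
  also have "(\<Sum>r\<in>{1..n}. if i = r then a * prod_list (map (\<lambda>x. a * of_bool (x = r) + b x) xs) else 0)
    = a * prod_list (map (\<lambda>x. a * of_bool (x = i) + b x) xs)"
    using assms by simp
  finally show ?thesis .
qed

lemma edge_tensor_Nil: "edge_tensor n c d [] = of_nat (n choose 2)"
  by (simp add: edge_tensor_def card_edges)

lemma sum_edges_at:
  fixes f :: "nat set \<Rightarrow> 'a::comm_monoid_add"
  assumes "i \<in> {1..n}"
  shows "(\<Sum>S | S \<in> edges n \<and> i \<in> S. f S) = (\<Sum>r\<in>{1..n} - {i}. f {i, r})"
proof -
  have "{S. S \<in> edges n \<and> i \<in> S} = (\<lambda>r. {i, r}) ` ({1..n} - {i})"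
  proof (intro equalityI subsetI)
    fix S assume "S \<in> {S. S \<in> edges n \<and> i \<in> S}"
    then have S: "S \<subseteq> {1..n}" "card S = 2" "i \<in> S" by (auto simp: edges_def)
    then obtain p q where "S = {p, q}" "p \<noteq> q" by (auto simp: card_2_iff)
    with S show "S \<in> (\<lambda>r. {i, r}) ` ({1..n} - {i})" by auto
  qed (use assms in \<open>auto simp: edges_def card_2_iff\<close>)
  moreover have "inj_on (\<lambda>r. {i, r}) ({1..n} - {i})"
    by (auto simp: inj_on_def doubleton_eq_iff)
  ultimately show ?thesis
    by (simp add: sum.reindex)
qed

text \<open>The \<open>c\<close> part keeps only the edges at \<open>i\<close>. Summing over the
  other endpoint gives a vertex sum whose shift is \<open>c + d\<close> at \<open>i\<close> and
  \<open>d\<close> elsewhere; the term \<open>r = i\<close> is not an edge and is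
  subtracted.\<close>

lemma edge_tensor_Cons:
  assumes "i \<in> {1..n}"
  shows "edge_tensor n c d (i # xs) =
    c * (vertex_tensor n c (\<lambda>x. c * of_bool (x = i) + d) xs
         - prod_list (map (\<lambda>x. c * of_bool (x = i) + (c * of_bool (x = i) + d)) xs))
    + d * edge_tensor n c d xs"
proof -
  let ?f = "\<lambda>S. prod_list (map (\<lambda>x. c * of_bool (x \<in> S) + d) xs)"
  let ?g = "\<lambda>r. prod_list (map (\<lambda>x. c * of_bool (x = r) + (c * of_bool (x = i) + d)) xs)"
  have "(c * of_bool (i \<in> S) + d) * p = (if i \<in> S then c * p else 0) + d * p" for S p
    by (simp add: distrib_right)
  then have "edge_tensor n c d (i # xs) = (\<Sum>S\<in>edges n. if i \<in> S then c * ?f S else 0)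
     + d * edge_tensor n c d xs"
    by (simp only: edge_tensor_def list.map prod_list.Cons sum.distrib sum_distrib_left)
  also have "(\<Sum>S\<in>edges n. if i \<in> S then c * ?f S else 0) = (\<Sum>S | S \<in> edges n \<and> i \<in> S. c * ?f S)"
    by (simp add: sum.inter_filter)
  also have "\<dots> = (\<Sum>r\<in>{1..n} - {i}. c * ?f {i, r})"
    by (rule sum_edges_at[OF assms])
  also have "\<dots> = (\<Sum>r\<in>{1..n} - {i}. c * ?g r)"
  proof (rule sum.cong[OF refl])
    fix r assume "r \<in> {1..n} - {i}"
    then have "c * of_bool (x \<in> {i, r}) + d = c * of_bool (x = r) + (c * of_bool (x = i) + d)" for x
      by auto
    then show "c * ?f {i, r} = c * ?g r" by presburger
  qed
  also have "\<dots> = c * ((\<Sum>r\<in>{1..n}. ?g r) - ?g i)"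
    using assms by (simp add: sum_diff1 sum_distrib_left right_diff_distrib)
  finally show ?thesis
    by (simp add: vertex_tensor_def)
qed

lemma tensor_form_vertex:
  "tensor_form n m (vertex_tensor n a b) =
    (\<Sum>r\<in>{1..n}. linear_form n (\<lambda>x. a * of_bool (x = r) + b x) ^ m)"
  unfolding vertex_tensor_def tensor_form_sum linear_form_power ..

lemma tensor_form_edge:
  "tensor_form n m (edge_tensor n c d) =
    (\<Sum>S\<in>edges n. linear_form n (\<lambda>x. c * of_bool (x \<in> S) + d) ^ m)"
  unfolding edge_tensor_def tensor_form_sum linear_form_power ..

lemmas orbit_tensor_simps =
  vertex_tensor_Nil vertex_tensor_Cons edge_tensor_Nil edge_tensor_Cons

section \<open>Symmetric quartics\<close>

text \<open>\<open>quartic_type n g A B C D E\<close> says that \<open>g\<close> is the tensor of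
  \<open>A p\<^sub>4 + 4 B p\<^sub>3 p\<^sub>1 + 3 C p\<^sub>2\<^sup>2 + 6 D p\<^sub>2 p\<^sub>1\<^sup>2 + E p\<^sub>1\<^sup>4\<close>: an equality pattern of the indices collects the
  coefficients of all set partitions that refine it.\<close>

definition quartic_type ::
  "nat \<Rightarrow> (nat list \<Rightarrow> 'a::comm_ring_1) \<Rightarrow> 'a \<Rightarrow> 'a \<Rightarrow> 'a \<Rightarrow> 'a \<Rightarrow> 'a \<Rightarrow> bool" where
  "quartic_type n g A B C D E \<longleftrightarrow> mset_invariant g \<and>
    (\<forall>i j k l. set [i, j, k, l] \<subseteq> {1..n} \<and> distinct [i, j, k, l] \<longrightarrow> g [i, j, k, l] = E) \<and>
    (\<forall>i j k. set [i, j, k] \<subseteq> {1..n} \<and> distinct [i, j, k] \<longrightarrow> g [i, i, j, k] = D + E) \<and>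
    (\<forall>i j. set [i, j] \<subseteq> {1..n} \<and> distinct [i, j] \<longrightarrow> g [i, i, j, j] = C + 2 * D + E) \<and>
    (\<forall>i j. set [i, j] \<subseteq> {1..n} \<and> distinct [i, j] \<longrightarrow> g [i, i, i, j] = B + 3 * D + E) \<and>
    (\<forall>i. set [i] \<subseteq> {1..n} \<and> distinct [i] \<longrightarrow> g [i, i, i, i] = A + 4 * B + 3 * C + 6 * D + E)"

text \<open>Both tensors are invariant under sorting, and a sorted word has one of eight equality
  patterns, each a rearrangement of one of the five in the definition.\<close>

lemma quartic_type_unique:
  assumes g: "quartic_type n g A B C D E" and h: "quartic_type n h A B C D E"
    and xs: "xs \<in> tuples n 4"
  shows "g xs = h xs"
proof -
  have gi: "mset_invariant g" and hi: "mset_invariant h"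
    using g h by (auto simp: quartic_type_def)
  have sorted_eq: "g ys = h ys" if ys: "sorted ys" "set ys \<subseteq> {1..n}" "length ys = 4" for ys
  proof -
    have reorder: "g us = h us" if "mset us = mset vs" "g vs = h vs" for us vs
      using that mset_invariantD[OF gi that(1)] mset_invariantD[OF hi that(1)] by simp
    obtain i j k l where ijkl: "ys = [i, j, k, l]"
      using ys(3) by (auto simp: length_Suc_conv numeral_eq_Suc)
    have le: "i \<le> j" "j \<le> k" "k \<le> l" and mem: "{i, j, k, l} \<subseteq> {1..n}"
      using ys unfolding ijkl by auto
    consider "i = j" "j = k" "k = l" | "i = j" "j = k" "k < l" | "i = j" "j < k" "k = l"
      | "i = j" "j < k" "k < l" | "i < j" "j = k" "k = l" | "i < j" "j = k" "k < l"
      | "i < j" "j < k" "k = l" | "i < j" "j < k" "k < l"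
      using le unfolding le_less by blast
    then show ?thesis
    proof cases
      \<comment> \<open>In cases 5 to 7 the repeated index is not in front, so the word is
        rearranged first.\<close>
      case 5
      have "g [l, l, l, i] = h [l, l, l, i]" using g h mem 5 by (simp add: quartic_type_def)
      then show ?thesis using reorder[of "[i, j, k, l]" "[l, l, l, i]"] 5 by (simp add: ijkl)
    next
      case 6
      have "g [j, j, i, l] = h [j, j, i, l]" using g h mem 6 by (simp add: quartic_type_def)
      then show ?thesis using reorder[of "[i, j, k, l]" "[j, j, i, l]"] 6 by (simp add: ijkl)
    next
      case 7
      have "g [l, l, i, j] = h [l, l, i, j]" using g h mem 7 by (simp add: quartic_type_def)
      then show ?thesis using reorder[of "[i, j, k, l]" "[l, l, i, j]"] 7 by (simp add: ijkl)
    qed (use g h mem in \<open>simp_all add: quartic_type_def ijkl\<close>)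
  qed
  have "g xs = g (sort xs)" "h xs = h (sort xs)"
    using mset_invariantD[OF gi, of xs "sort xs"] mset_invariantD[OF hi, of xs "sort xs"] by simp_all
  moreover have "g (sort xs) = h (sort xs)"
    using xs by (intro sorted_eq) (auto simp: tuples_def)
  ultimately show ?thesis by simp
qed

lemma quartic_type_orbits:
  fixes a b c d e :: "'a::comm_ring_1"
  shows "quartic_type n (\<lambda>xs. vertex_tensor n a (\<lambda>_. b) xs + edge_tensor n c d xs
      + prod_list (map (\<lambda>_. e) xs))
    (a ^ 4 + (of_nat n - 8) * c ^ 4)
    (a ^ 3 * b + c ^ 4 + (of_nat n - 4) * c ^ 3 * d)
    (c ^ 4)
    (a\<^sup>2 * b\<^sup>2 + 2 * c ^ 3 * d + (of_nat n - 2) * c\<^sup>2 * d\<^sup>2)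
    (of_nat n * b ^ 4 + 4 * a * b ^ 3 + 6 * c\<^sup>2 * d\<^sup>2 + 4 * (of_nat n - 1) * c * d ^ 3
      + of_nat (n choose 2) * d ^ 4 + e ^ 4)"
  unfolding quartic_type_def
proof (intro conjI allI impI)
  show "mset_invariant (\<lambda>xs. vertex_tensor n a (\<lambda>_. b) xs + edge_tensor n c d xs
      + prod_list (map (\<lambda>_. e) xs))"
    by (intro mset_invariant_add mset_invariant_vertex mset_invariant_edge mset_invariant_prod_list)
qed (simp_all add: orbit_tensor_simps, simp_all add: algebra_simps power_numeral_reduce)

section \<open>Symmetric quintics\<close>

text \<open>The same encoding for the quintic combination of power sums. For instance,
  \<open>[i, i, i, j, j]\<close> is refined by one set partition of type 3+2, one of type 3+1+1,
  three of type 2+2+1, four of type 2+1+1+1 and the discrete one.\<close>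

definition quintic_type ::
  "nat \<Rightarrow> (nat list \<Rightarrow> 'a::comm_ring_1) \<Rightarrow> 'a \<Rightarrow> 'a \<Rightarrow> 'a \<Rightarrow> 'a \<Rightarrow> 'a \<Rightarrow> 'a \<Rightarrow> 'a \<Rightarrow> bool" where
  "quintic_type n g A B Q G R H E \<longleftrightarrow> mset_invariant g \<and>
    (\<forall>i j k l m. set [i, j, k, l, m] \<subseteq> {1..n} \<and> distinct [i, j, k, l, m] \<longrightarrow> g [i, j, k, l, m] = E) \<and>
    (\<forall>i j k l. set [i, j, k, l] \<subseteq> {1..n} \<and> distinct [i, j, k, l] \<longrightarrow> g [i, i, j, k, l] = H + E) \<and>
    (\<forall>i j k. set [i, j, k] \<subseteq> {1..n} \<and> distinct [i, j, k] \<longrightarrow> g [i, i, j, j, k] = R + 2 * H + E) \<and>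
    (\<forall>i j k. set [i, j, k] \<subseteq> {1..n} \<and> distinct [i, j, k] \<longrightarrow> g [i, i, i, j, k] = G + 3 * H + E) \<and>
    (\<forall>i j. set [i, j] \<subseteq> {1..n} \<and> distinct [i, j] \<longrightarrow> g [i, i, i, j, j] = Q + G + 3 * R + 4 * H + E) \<and>
    (\<forall>i j. set [i, j] \<subseteq> {1..n} \<and> distinct [i, j] \<longrightarrow> g [i, i, i, i, j] = B + 4 * G + 3 * R + 6 * H + E) \<and>
    (\<forall>i. set [i] \<subseteq> {1..n} \<and> distinct [i] \<longrightarrow> g [i, i, i, i, i] = A + 5 * B + 10 * Q + 10 * G + 15 * R + 10 * H + E)"

lemma quintic_type_unique:
  assumes g: "quintic_type n g A B Q G R H E" and h: "quintic_type n h A B Q G R H E"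
    and xs: "xs \<in> tuples n 5"
  shows "g xs = h xs"
proof -
  have gi: "mset_invariant g" and hi: "mset_invariant h"
    using g h by (auto simp: quintic_type_def)
  have sorted_eq: "g ys = h ys" if ys: "sorted ys" "set ys \<subseteq> {1..n}" "length ys = 5" for ys
  proof -
    have reorder: "g us = h us" if "mset us = mset vs" "g vs = h vs" for us vs
      using that mset_invariantD[OF gi that(1)] mset_invariantD[OF hi that(1)] by simp
    obtain i j k l m where ijklm: "ys = [i, j, k, l, m]"
      using ys(3) by (auto simp: length_Suc_conv numeral_eq_Suc)
    have le: "i \<le> j" "j \<le> k" "k \<le> l" "l \<le> m" and mem: "{i, j, k, l, m} \<subseteq> {1..n}"
      using ys unfolding ijklm by auto
    consider "i = j" "j = k" "k = l" "l = m"
      | "i = j" "j = k" "k = l" "l < m"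
      | "i = j" "j = k" "k < l" "l = m"
      | "i = j" "j = k" "k < l" "l < m"
      | "i = j" "j < k" "k = l" "l = m"
      | "i = j" "j < k" "k = l" "l < m"
      | "i = j" "j < k" "k < l" "l = m"
      | "i = j" "j < k" "k < l" "l < m"
      | "i < j" "j = k" "k = l" "l = m"
      | "i < j" "j = k" "k = l" "l < m"
      | "i < j" "j = k" "k < l" "l = m"
      | "i < j" "j = k" "k < l" "l < m"
      | "i < j" "j < k" "k = l" "l = m"
      | "i < j" "j < k" "k = l" "l < m"
      | "i < j" "j < k" "k < l" "l = m"
      | "i < j" "j < k" "k < l" "l < m"
      using le unfolding le_less by (elim disjE; meson)
    then show ?thesis
    proof cases
      case 5
      have "g [k, k, k, i, i] = h [k, k, k, i, i]"
        using g h mem 5 by (simp add: quintic_type_def)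
      then show ?thesis using reorder[of "[i, j, k, l, m]" "[k, k, k, i, i]"] 5 by (simp add: ijklm)
    next
      case 7
      have "g [i, i, l, l, k] = h [i, i, l, l, k]"
        using g h mem 7 by (simp add: quintic_type_def)
      then show ?thesis using reorder[of "[i, j, k, l, m]" "[i, i, l, l, k]"] 7 by (simp add: ijklm)
    next
      case 9
      have "g [j, j, j, j, i] = h [j, j, j, j, i]"
        using g h mem 9 by (simp add: quintic_type_def)
      then show ?thesis using reorder[of "[i, j, k, l, m]" "[j, j, j, j, i]"] 9 by (simp add: ijklm)
    next
      case 10
      have "g [j, j, j, i, m] = h [j, j, j, i, m]"
        using g h mem 10 by (simp add: quintic_type_def)
      then show ?thesis using reorder[of "[i, j, k, l, m]" "[j, j, j, i, m]"] 10 by (simp add: ijklm)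
    next
      case 11
      have "g [j, j, l, l, i] = h [j, j, l, l, i]"
        using g h mem 11 by (simp add: quintic_type_def)
      then show ?thesis using reorder[of "[i, j, k, l, m]" "[j, j, l, l, i]"] 11 by (simp add: ijklm)
    next
      case 12
      have "g [j, j, i, l, m] = h [j, j, i, l, m]"
        using g h mem 12 by (simp add: quintic_type_def)
      then show ?thesis using reorder[of "[i, j, k, l, m]" "[j, j, i, l, m]"] 12 by (simp add: ijklm)
    next
      case 13
      have "g [k, k, k, i, j] = h [k, k, k, i, j]"
        using g h mem 13 by (simp add: quintic_type_def)
      then show ?thesis using reorder[of "[i, j, k, l, m]" "[k, k, k, i, j]"] 13 by (simp add: ijklm)
    next
      case 14
      have "g [k, k, i, j, m] = h [k, k, i, j, m]"
        using g h mem 14 by (simp add: quintic_type_def)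
      then show ?thesis using reorder[of "[i, j, k, l, m]" "[k, k, i, j, m]"] 14 by (simp add: ijklm)
    next
      case 15
      have "g [l, l, i, j, k] = h [l, l, i, j, k]"
        using g h mem 15 by (simp add: quintic_type_def)
      then show ?thesis using reorder[of "[i, j, k, l, m]" "[l, l, i, j, k]"] 15 by (simp add: ijklm)
    qed (use g h mem in \<open>simp_all add: quintic_type_def ijklm\<close>)
  qed
  have "g xs = g (sort xs)" "h xs = h (sort xs)"
    using mset_invariantD[OF gi, of xs "sort xs"] mset_invariantD[OF hi, of xs "sort xs"] by simp_all
  moreover have "g (sort xs) = h (sort xs)"
    using xs by (intro sorted_eq) (auto simp: tuples_def)
  ultimately show ?thesis by simp
qed

text \<open>Only the edge orbit produces \<open>p_3 p_2\<close> and \<open>p_2^2 p_1\<close>, so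
  \<open>Q\<close> and \<open>R\<close> involve just \<open>c\<close> and \<open>d\<close>. The
  constants 16, 8, 4, 2 are again \<open>2^(k-1)\<close>.\<close>

lemma quintic_type_orbits:
  fixes a b a' b' c d e :: "'a::comm_ring_1"
  shows "quintic_type n (\<lambda>xs. vertex_tensor n a (\<lambda>_. b) xs + vertex_tensor n a' (\<lambda>_. b') xs
      + edge_tensor n c d xs + prod_list (map (\<lambda>_. e) xs))
    (a ^ 5 + a' ^ 5 + (of_nat n - 16) * c ^ 5)
    (a ^ 4 * b + a' ^ 4 * b' + c ^ 5 + (of_nat n - 8) * c ^ 4 * d)
    (c ^ 5)
    (a ^ 3 * b\<^sup>2 + a' ^ 3 * b'\<^sup>2 + 2 * c ^ 4 * d + (of_nat n - 4) * c ^ 3 * d\<^sup>2)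
    (c ^ 4 * d)
    (a\<^sup>2 * b ^ 3 + a'\<^sup>2 * b' ^ 3 + 3 * c ^ 3 * d\<^sup>2 + (of_nat n - 2) * c\<^sup>2 * d ^ 3)
    (of_nat n * b ^ 5 + 5 * a * b ^ 4 + of_nat n * b' ^ 5 + 5 * a' * b' ^ 4
      + 10 * c\<^sup>2 * d ^ 3 + 5 * (of_nat n - 1) * c * d ^ 4
      + of_nat (n choose 2) * d ^ 5 + e ^ 5)"
  unfolding quintic_type_def
proof (intro conjI allI impI)
  show "mset_invariant (\<lambda>xs. vertex_tensor n a (\<lambda>_. b) xs + vertex_tensor n a' (\<lambda>_. b') xs
      + edge_tensor n c d xs + prod_list (map (\<lambda>_. e) xs))"
    by (intro mset_invariant_add mset_invariant_vertex mset_invariant_edge mset_invariant_prod_list)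
qed (clarsimp simp: orbit_tensor_simps, simp add: algebra_simps power_numeral_reduce)+

section \<open>Coordinates of a symmetric form\<close>

text \<open>The fallback value \<open>w\<close> is used if \<open>n\<close> is too small for the monomial of \<open>xs\<close> to exist. It makes
  the coordinates of the chosen base points agree with those for large \<open>n\<close>.\<close>

definition word_coeff :: "nat \<Rightarrow> nat list \<Rightarrow> 'a \<Rightarrow> (nat monomial \<Rightarrow> 'a) \<Rightarrow> 'a::field_char_0" where
  "word_coeff n xs w x = (if set xs \<subseteq> {1..n}
     then x (word_monomial xs) / of_nat (card (permutations_of_multiset (mset xs))) else w)"

text \<open>The case distinction depends on \<open>n\<close> and \<open>xs\<close> but not on the
  coefficients, so the function is either linear or constant.\<close>

lemma polynomial_fun_word_coeff [polynomial_intros]: "polynomial_fun (word_coeff n xs w)"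
proof (cases "set xs \<subseteq> {1..n}")
  case True
  then have "word_coeff n xs w =
    (\<lambda>x. x (word_monomial xs) * (1 / of_nat (card (permutations_of_multiset (mset xs)))))"
    by (simp add: word_coeff_def fun_eq_iff)
  then show ?thesis by (simp only:) (intro polynomial_intros)
next
  case False
  then have "word_coeff n xs w = (\<lambda>x. w)"
    by (simp add: word_coeff_def fun_eq_iff)
  then show ?thesis by (simp only:) (intro polynomial_intros)
qed

text \<open>Either the word fits into \<open>n\<close> variables and the value is read off
  \<open>g\<close>, or the fallback is returned. The coordinates of a base point thus follow one
  formula for all \<open>n\<close>.\<close>

lemma word_coeff_tensor_form:
  assumes "mset_invariant g" "length xs = m" "set xs \<subseteq> {1..n} \<Longrightarrow> g xs = w"
  shows "word_coeff n xs w (Poly_Mapping.lookup (tensor_form n m g)) = w"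
proof (cases "set xs \<subseteq> {1..n}")
  case True
  then have "form_tensor (tensor_form n m g) xs = w"
    using form_tensor_tensor_form[OF assms(1), of xs n m] assms by (simp add: tuples_def)
  then show ?thesis by (simp add: word_coeff_def form_tensor_def)
qed (simp add: word_coeff_def)

text \<open>The enumeration of \<open>ys\<close> is extended by any bijection between the
  complements, which have equal size.\<close>

lemma permutation_onto_distinct:
  assumes "distinct ys" "set ys \<subseteq> {1..n}"
  shows "\<exists>\<pi>. \<pi> permutes {1..n} \<and> (\<forall>j\<in>{1..length ys}. \<pi> j = ys ! (j - 1))"
proof -
  let ?k = "length ys"
  have k: "?k \<le> n"
    using card_mono[OF _ assms(2)] assms(1) by (simp add: distinct_card)
  have "card ({1..n} - {1..?k}) = card ({1..n} - set ys)"
    using assms k by (simp add: card_Diff_subset distinct_card)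
  then obtain \<sigma> where \<sigma>: "bij_betw \<sigma> ({1..n} - {1..?k}) ({1..n} - set ys)"
    using finite_same_card_bij by (metis finite_Diff finite_atLeastAtMost)
  define \<pi> where "\<pi> j = (if j \<in> {1..?k} then ys ! (j - 1) else if j \<in> {1..n} then \<sigma> j else j)" for j
  have 1: "bij_betw \<pi> {1..?k} (set ys)"
  proof (rule bij_betw_imageI)
    show "inj_on \<pi> {1..?k}"
      using assms(1) by (auto simp: inj_on_def \<pi>_def nth_eq_iff_index_eq)
    show "\<pi> ` {1..?k} = set ys"
    proof (intro equalityI subsetI)
      fix y assume "y \<in> set ys"
      then obtain j where "j < ?k" "y = ys ! j" by (auto simp: in_set_conv_nth)
      then show "y \<in> \<pi> ` {1..?k}"
        \<comment> \<open>List positions start at 0 and variables at 1.\<close>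
        by (intro image_eqI[of _ _ "Suc j"]) (auto simp: \<pi>_def)
    qed (auto simp: \<pi>_def)
  qed
  have 2: "bij_betw \<pi> ({1..n} - {1..?k}) ({1..n} - set ys)"
    using \<sigma> by (rule bij_betw_cong[THEN iffD1, rotated]) (auto simp: \<pi>_def)
  have "bij_betw \<pi> ({1..?k} \<union> ({1..n} - {1..?k})) (set ys \<union> ({1..n} - set ys))"
    by (rule bij_betw_combine[OF 1 2]) blast
  moreover have "{1..?k} \<union> ({1..n} - {1..?k}) = {1..n}" "set ys \<union> ({1..n} - set ys) = {1..n}"
    using k assms(2) by auto
  ultimately have "\<pi> permutes {1..n}"
    using k by (intro bij_imp_permutes) (auto simp: \<pi>_def)
  then show ?thesis
    by (intro exI[of _ \<pi>]) (auto simp: \<pi>_def)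
qed

text \<open>A permutation carries the standard word \<open>js\<close> to the given one. Since the
  distinct letters \<open>ys\<close> exist, \<open>n\<close> is large enough for \<open>js\<close>,
  so the fallback \<open>w\<close> is not taken.\<close>

lemma form_tensor_word_coeff:
  assumes F: "F \<in> symmetric_forms n m" and ys: "set ys \<subseteq> {1..n}" "distinct ys"
    and js: "set js \<subseteq> {1..length ys}"
  shows "form_tensor F (map (\<lambda>j. ys ! (j - 1)) js) = word_coeff n js w (Poly_Mapping.lookup F)"
proof -
  obtain \<pi> where \<pi>: "\<pi> permutes {1..n}" "\<forall>j\<in>{1..length ys}. \<pi> j = ys ! (j - 1)"
    using permutation_onto_distinct[OF ys(2,1)] by blast
  have "length ys \<le> n"
    using card_mono[OF _ ys(1)] ys(2) by (simp add: distinct_card)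
  then have "set js \<subseteq> {1..n}"
    using js by auto
  have "map (\<lambda>j. ys ! (j - 1)) js = map \<pi> js"
    using \<pi>(2) js by auto
  then have "form_tensor F (map (\<lambda>j. ys ! (j - 1)) js) = form_tensor F js"
    by (simp only: form_tensor_permutes[OF F \<pi>(1)])
  with \<open>set js \<subseteq> {1..n}\<close> show ?thesis
    by (simp only: word_coeff_def form_tensor_def if_True)
qed

text \<open>The hypotheses are triangular in \<open>E\<close>, \<open>D\<close>, \<open>C\<close>,
  \<open>B\<close>, \<open>A\<close>, so successive subtraction solves them. The fallbacks are
  arbitrary because a pattern that does not fit imposes no condition.\<close>

lemma quartic_type_form_tensor:
  assumes F: "F \<in> symmetric_forms n 4"
  defines "x \<equiv> Poly_Mapping.lookup F"
  assumes "word_coeff n [1, 2, 3, 4] w1 x = E"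
    and "word_coeff n [1, 1, 2, 3] w2 x = D + E"
    and "word_coeff n [1, 1, 2, 2] w3 x = C + 2 * D + E"
    and "word_coeff n [1, 1, 1, 2] w4 x = B + 3 * D + E"
    and "word_coeff n [1, 1, 1, 1] w5 x = A + 4 * B + 3 * C + 6 * D + E"
  shows "quartic_type n (form_tensor F) A B C D E"
proof -
  have 1: "form_tensor F [i, j, k, l] = word_coeff n [1, 2, 3, 4] w1 x"
    if "set [i, j, k, l] \<subseteq> {1..n} \<and> distinct [i, j, k, l]" for i j k l
    using form_tensor_word_coeff[OF F, of "[i, j, k, l]" "[1, 2, 3, 4]" w1] that by (simp add: x_def)
  have 2: "form_tensor F [i, i, j, k] = word_coeff n [1, 1, 2, 3] w2 x"
    if "set [i, j, k] \<subseteq> {1..n} \<and> distinct [i, j, k]" for i j k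
    using form_tensor_word_coeff[OF F, of "[i, j, k]" "[1, 1, 2, 3]" w2] that by (simp add: x_def)
  have 3: "form_tensor F [i, i, j, j] = word_coeff n [1, 1, 2, 2] w3 x"
    if "set [i, j] \<subseteq> {1..n} \<and> distinct [i, j]" for i j
    using form_tensor_word_coeff[OF F, of "[i, j]" "[1, 1, 2, 2]" w3] that by (simp add: x_def)
  have 4: "form_tensor F [i, i, i, j] = word_coeff n [1, 1, 1, 2] w4 x"
    if "set [i, j] \<subseteq> {1..n} \<and> distinct [i, j]" for i j
    using form_tensor_word_coeff[OF F, of "[i, j]" "[1, 1, 1, 2]" w4] that by (simp add: x_def)
  have 5: "form_tensor F [i, i, i, i] = word_coeff n [1, 1, 1, 1] w5 x"
    if "set [i] \<subseteq> {1..n} \<and> distinct [i]" for i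
    using form_tensor_word_coeff[OF F, of "[i]" "[1, 1, 1, 1]" w5] that by (simp add: x_def)
  show ?thesis
    unfolding quartic_type_def
    using mset_invariant_form_tensor[of F] 1[unfolded assms(3)] 2[unfolded assms(4)] 3[unfolded assms(5)] 4[unfolded assms(6)] 5[unfolded assms(7)]
    by blast
qed

lemma quintic_type_form_tensor:
  assumes F: "F \<in> symmetric_forms n 5"
  defines "x \<equiv> Poly_Mapping.lookup F"
  assumes "word_coeff n [1, 2, 3, 4, 5] w1 x = E"
    and "word_coeff n [1, 1, 2, 3, 4] w2 x = H + E"
    and "word_coeff n [1, 1, 2, 2, 3] w3 x = R + 2 * H + E"
    and "word_coeff n [1, 1, 1, 2, 3] w4 x = G + 3 * H + E"
    and "word_coeff n [1, 1, 1, 2, 2] w5 x = Q + G + 3 * R + 4 * H + E"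
    and "word_coeff n [1, 1, 1, 1, 2] w6 x = B + 4 * G + 3 * R + 6 * H + E"
    and "word_coeff n [1, 1, 1, 1, 1] w7 x = A + 5 * B + 10 * Q + 10 * G + 15 * R + 10 * H + E"
  shows "quintic_type n (form_tensor F) A B Q G R H E"
proof -
  have 1: "form_tensor F [i, j, k, l, m] = word_coeff n [1, 2, 3, 4, 5] w1 x"
    if "set [i, j, k, l, m] \<subseteq> {1..n} \<and> distinct [i, j, k, l, m]" for i j k l m
    using form_tensor_word_coeff[OF F, of "[i, j, k, l, m]" "[1, 2, 3, 4, 5]" w1] that by (simp add: x_def)
  have 2: "form_tensor F [i, i, j, k, l] = word_coeff n [1, 1, 2, 3, 4] w2 x"
    if "set [i, j, k, l] \<subseteq> {1..n} \<and> distinct [i, j, k, l]" for i j k l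
    using form_tensor_word_coeff[OF F, of "[i, j, k, l]" "[1, 1, 2, 3, 4]" w2] that by (simp add: x_def)
  have 3: "form_tensor F [i, i, j, j, k] = word_coeff n [1, 1, 2, 2, 3] w3 x"
    if "set [i, j, k] \<subseteq> {1..n} \<and> distinct [i, j, k]" for i j k
    using form_tensor_word_coeff[OF F, of "[i, j, k]" "[1, 1, 2, 2, 3]" w3] that by (simp add: x_def)
  have 4: "form_tensor F [i, i, i, j, k] = word_coeff n [1, 1, 1, 2, 3] w4 x"
    if "set [i, j, k] \<subseteq> {1..n} \<and> distinct [i, j, k]" for i j k
    using form_tensor_word_coeff[OF F, of "[i, j, k]" "[1, 1, 1, 2, 3]" w4] that by (simp add: x_def)
  have 5: "form_tensor F [i, i, i, j, j] = word_coeff n [1, 1, 1, 2, 2] w5 x"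
    if "set [i, j] \<subseteq> {1..n} \<and> distinct [i, j]" for i j
    using form_tensor_word_coeff[OF F, of "[i, j]" "[1, 1, 1, 2, 2]" w5] that by (simp add: x_def)
  have 6: "form_tensor F [i, i, i, i, j] = word_coeff n [1, 1, 1, 1, 2] w6 x"
    if "set [i, j] \<subseteq> {1..n} \<and> distinct [i, j]" for i j
    using form_tensor_word_coeff[OF F, of "[i, j]" "[1, 1, 1, 1, 2]" w6] that by (simp add: x_def)
  have 7: "form_tensor F [i, i, i, i, i] = word_coeff n [1, 1, 1, 1, 1] w7 x"
    if "set [i] \<subseteq> {1..n} \<and> distinct [i]" for i
    using form_tensor_word_coeff[OF F, of "[i]" "[1, 1, 1, 1, 1]" w7] that by (simp add: x_def)
  show ?thesis
    unfolding quintic_type_def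
    using mset_invariant_form_tensor[of F] 1[unfolded assms(3)] 2[unfolded assms(4)] 3[unfolded assms(5)] 4[unfolded assms(6)] 5[unfolded assms(7)] 6[unfolded assms(8)] 7[unfolded assms(9)]
    by blast
qed

lemma mset_invariant_map: "mset_invariant g \<Longrightarrow> mset_invariant (\<lambda>xs. g (map f xs))"
  unfolding mset_invariant_def by (metis mset_map)

text \<open>Composition with a permutation preserves all pattern values, so uniqueness identifies
  the composed tensor with \<open>g\<close>.\<close>

lemma tensor_form_quartic_symmetric:
  assumes g: "quartic_type n g A B C D E"
  shows "tensor_form n 4 g \<in> symmetric_forms n 4"
proof (rule tensor_form_symmetric)
  fix \<pi> xs assume \<pi>: "\<pi> permutes {1..n}" and xs: "xs \<in> tuples n 4"
  have img: "set (map \<pi> ys) \<subseteq> {1..n} \<and> distinct (map \<pi> ys)"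
    if "set ys \<subseteq> {1..n} \<and> distinct ys" for ys
    using that image_mono[of "set ys" "{1..n}" \<pi>] permutes_image[OF \<pi>]
      inj_on_subset[OF permutes_inj[OF \<pi>] subset_UNIV]
    by (simp only: set_map distinct_map)
  have "quartic_type n (\<lambda>xs. g (map \<pi> xs)) A B C D E"
    unfolding quartic_type_def
  proof (intro conjI allI impI)
    show "mset_invariant (\<lambda>xs. g (map \<pi> xs))"
      by (rule mset_invariant_map) (use g in \<open>simp add: quartic_type_def\<close>)
  qed (drule img, use g in \<open>unfold quartic_type_def list.map, blast\<close>)+
  then show "g (map \<pi> xs) = g xs"
    using quartic_type_unique[OF _ g xs] by blast
qed

lemma tensor_form_quintic_symmetric:
  assumes g: "quintic_type n g A B Q G R H E"
  shows "tensor_form n 5 g \<in> symmetric_forms n 5"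
proof (rule tensor_form_symmetric)
  fix \<pi> xs assume \<pi>: "\<pi> permutes {1..n}" and xs: "xs \<in> tuples n 5"
  have img: "set (map \<pi> ys) \<subseteq> {1..n} \<and> distinct (map \<pi> ys)"
    if "set ys \<subseteq> {1..n} \<and> distinct ys" for ys
    using that image_mono[of "set ys" "{1..n}" \<pi>] permutes_image[OF \<pi>]
      inj_on_subset[OF permutes_inj[OF \<pi>] subset_UNIV]
    by (simp only: set_map distinct_map)
  have "quintic_type n (\<lambda>xs. g (map \<pi> xs)) A B Q G R H E"
    unfolding quintic_type_def
  proof (intro conjI allI impI)
    show "mset_invariant (\<lambda>xs. g (map \<pi> xs))"
      by (rule mset_invariant_map) (use g in \<open>simp add: quintic_type_def\<close>)
  qed (drule img, use g in \<open>unfold quintic_type_def list.map, blast\<close>)+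
  then show "g (map \<pi> xs) = g xs"
    using quintic_type_unique[OF _ g xs] by blast
qed

section \<open>Solving for the linear forms\<close>

lemma quadratic_root_exists:
  fixes k0 k1 k2 :: "'K::alg_closed_field"
  assumes "k2 \<noteq> 0"
  shows "\<exists>t. k0 + k1 * t + k2 * t\<^sup>2 = 0"
proof -
  obtain t where "poly [:k0, k1, k2:] t = 0"
    using alg_closed_imp_poly_has_root[of "[:k0, k1, k2:]"] assms by auto
  then show ?thesis
    by (intro exI[of _ t]) (simp add: algebra_simps power2_eq_square)
qed

text \<open>With \<open>w = a^4\<close>, \<open>s = b / a\<close> and \<open>t = d / c\<close>, the
  equations prescribe \<open>w * s\<close> and \<open>w * s^2\<close> in terms of \<open>t\<close>.
  The relation \<open>(w * s)^2 = w * (w * s^2)\<close> is then a quadratic in \<open>t\<close>,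
  with leading coefficient \<open>C\<close> times the expression in \<open>K\<close>.\<close>

lemma quartic_parameters_exist:
  fixes A B C D E N M :: "'K::alg_closed_field"
  assumes C: "C \<noteq> 0" and W: "A - (N - 8) * C \<noteq> 0"
    and K: "(N - 4)\<^sup>2 * C + (N - 2) * (A - (N - 8) * C) \<noteq> 0"
  shows "\<exists>a b c d e. A = a ^ 4 + (N - 8) * c ^ 4 \<and>
    B = a ^ 3 * b + c ^ 4 + (N - 4) * c ^ 3 * d \<and>
    C = c ^ 4 \<and>
    D = a\<^sup>2 * b\<^sup>2 + 2 * c ^ 3 * d + (N - 2) * c\<^sup>2 * d\<^sup>2 \<and>
    E = N * b ^ 4 + 4 * a * b ^ 3 + 6 * c\<^sup>2 * d\<^sup>2 + 4 * (N - 1) * c * d ^ 3 + M * d ^ 4 + e ^ 4"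
proof -
  define w where "w = A - (N - 8) * C"
  have w: "w \<noteq> 0" using W by (simp add: w_def)
  obtain c where c: "c ^ 4 = C" using nth_root_exists[of 4 C] by auto
  obtain a where a: "a ^ 4 = w" using nth_root_exists[of 4 w] by auto
  have "C * ((N - 4)\<^sup>2 * C + (N - 2) * w) \<noteq> 0"
    using C K by (simp add: w_def)
  then obtain t where t: "((B - C)\<^sup>2 - w * D) + (2 * C * w - 2 * (B - C) * (N - 4) * C) * t
      + C * ((N - 4)\<^sup>2 * C + (N - 2) * w) * t\<^sup>2 = 0"
    using quadratic_root_exists by blast
  define s where "s = (B - C - (N - 4) * C * t) / w"
  have ws: "w * s = B - C - (N - 4) * C * t"
    using w by (simp add: s_def)
  have "w * (w * s\<^sup>2) = (w * s)\<^sup>2"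
    by (simp add: power2_eq_square)
  also have "\<dots> = w * (D - 2 * C * t - (N - 2) * C * t\<^sup>2)"
    unfolding ws using t by algebra
  finally have wss: "w * s\<^sup>2 = D - 2 * C * t - (N - 2) * C * t\<^sup>2"
    using w by simp
  define b where "b = s * a"
  define d where "d = t * c"
  obtain e where e: "e ^ 4 = E - (N * b ^ 4 + 4 * a * b ^ 3 + 6 * c\<^sup>2 * d\<^sup>2
      + 4 * (N - 1) * c * d ^ 3 + M * d ^ 4)"
    using nth_root_exists[of 4] by auto
  have "a ^ 3 * b = w * s" "a\<^sup>2 * b\<^sup>2 = w * s\<^sup>2" "c ^ 3 * d = C * t" "c\<^sup>2 * d\<^sup>2 = C * t\<^sup>2"
    unfolding b_def d_def a[symmetric] c[symmetric] by (simp_all add: power_numeral_reduce algebra_simps)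
  then have "A = a ^ 4 + (N - 8) * c ^ 4 \<and> B = a ^ 3 * b + c ^ 4 + (N - 4) * c ^ 3 * d \<and>
    C = c ^ 4 \<and> D = a\<^sup>2 * b\<^sup>2 + 2 * c ^ 3 * d + (N - 2) * c\<^sup>2 * d\<^sup>2"
    using ws wss a c by (simp add: w_def mult.assoc)
  moreover have "E = N * b ^ 4 + 4 * a * b ^ 3 + 6 * c\<^sup>2 * d\<^sup>2 + 4 * (N - 1) * c * d ^ 3 + M * d ^ 4 + e ^ 4"
    unfolding e by simp
  ultimately show ?thesis by blast
qed

text \<open>Sylvester's method: the two nodes are the roots of the quadratic recurrence satisfied by
  \<open>\<alpha>, \<beta>, \<gamma>, \<delta>\<close>.\<close>

lemma sylvester_two_nodes:
  fixes \<alpha> \<beta> \<gamma> \<delta> :: "'K::alg_closed_field"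
  assumes m: "\<alpha> * \<gamma> - \<beta>\<^sup>2 \<noteq> 0"
    and disc: "(\<alpha> * \<delta> - \<beta> * \<gamma>)\<^sup>2 - 4 * (\<alpha> * \<gamma> - \<beta>\<^sup>2) * (\<beta> * \<delta> - \<gamma>\<^sup>2) \<noteq> 0"
  shows "\<exists>w s w' s'. w + w' = \<alpha> \<and> w * s + w' * s' = \<beta> \<and>
    w * s\<^sup>2 + w' * s'\<^sup>2 = \<gamma> \<and> w * s ^ 3 + w' * s' ^ 3 = \<delta>"
proof -
  define \<mu> where "\<mu> = \<alpha> * \<gamma> - \<beta>\<^sup>2"
  \<comment> \<open>Cramer's rule for
    \<open>\<sigma> * \<beta> - \<rho> * \<alpha> = \<gamma>\<close> and
    \<open>\<sigma> * \<gamma> - \<rho> * \<beta> = \<delta>\<close>, a system of determinant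
    \<open>\<mu>\<close>.\<close>
  define \<sigma> where "\<sigma> = (\<alpha> * \<delta> - \<beta> * \<gamma>) / \<mu>"
  define \<rho> where "\<rho> = (\<beta> * \<delta> - \<gamma>\<^sup>2) / \<mu>"
  have mu: "\<mu> \<noteq> 0" using m by (simp add: \<mu>_def)
  have sig: "\<mu> * \<sigma> = \<alpha> * \<delta> - \<beta> * \<gamma>" and rho: "\<mu> * \<rho> = \<beta> * \<delta> - \<gamma>\<^sup>2"
    using mu by (simp_all add: \<sigma>_def \<rho>_def)
  have "\<mu> * (\<sigma> * \<beta> - \<rho> * \<alpha>) = \<mu> * \<gamma>"
    using sig rho unfolding \<mu>_def by algebra
  then have g: "\<sigma> * \<beta> - \<rho> * \<alpha> = \<gamma>" using mu by simp
  have "\<mu> * (\<sigma> * \<gamma> - \<rho> * \<beta>) = \<mu> * \<delta>"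
    using sig rho unfolding \<mu>_def by algebra
  then have d: "\<sigma> * \<gamma> - \<rho> * \<beta> = \<delta>" using mu by simp
  obtain s where s: "\<rho> + (- \<sigma>) * s + 1 * s\<^sup>2 = 0"
    using quadratic_root_exists[of 1 \<rho> "- \<sigma>"] by auto
  define s' where "s' = \<sigma> - s"
  have \<sigma>: "\<sigma> = s + s'"
    by (simp add: s'_def)
  have \<rho>: "\<rho> = s * s'"
    using s unfolding s'_def by algebra
  \<comment> \<open>The expression in \<open>disc\<close> is \<open>\<mu>^2\<close> times the
    discriminant of the recurrence, so the two nodes are distinct.\<close>
  have "\<mu>\<^sup>2 * (\<sigma>\<^sup>2 - 4 * \<rho>) \<noteq> 0"
  proof -
    have "\<mu>\<^sup>2 * (\<sigma>\<^sup>2 - 4 * \<rho>) = (\<mu> * \<sigma>)\<^sup>2 - 4 * \<mu> * (\<mu> * \<rho>)" by algebra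
    then show ?thesis using disc unfolding sig rho by (simp add: \<mu>_def)
  qed
  moreover have "\<sigma>\<^sup>2 - 4 * \<rho> = (s - s')\<^sup>2"
    unfolding \<sigma> \<rho> by algebra
  ultimately have ne: "s - s' \<noteq> 0" by auto
  \<comment> \<open>The weights solve the Vandermonde system for the first two moments; the other
    two follow from the recurrence.\<close>
  define w where "w = (\<beta> - s' * \<alpha>) / (s - s')"
  define w' where "w' = \<alpha> - w"
  have w: "w * (s - s') = \<beta> - s' * \<alpha>" using ne by (simp add: w_def)
  have 1: "w * s + w' * s' = \<beta>" using w unfolding w'_def by algebra
  have 2: "w * s\<^sup>2 + w' * s'\<^sup>2 = \<gamma>"
  proof -
    have "w * s\<^sup>2 + w' * s'\<^sup>2 = (s + s') * (w * s + w' * s') - s * s' * (w + w')" by algebra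
    then show ?thesis unfolding 1 using g by (simp add: w'_def \<sigma> \<rho>)
  qed
  have 3: "w * s ^ 3 + w' * s' ^ 3 = \<delta>"
  proof -
    have "w * s ^ 3 + w' * s' ^ 3 = (s + s') * (w * s\<^sup>2 + w' * s'\<^sup>2) - s * s' * (w * s + w' * s')"
      by algebra
    then show ?thesis unfolding 1 2 using d by (simp add: \<sigma> \<rho>)
  qed
  have "w + w' = \<alpha>" by (simp add: w'_def)
  with 1 2 3 show ?thesis by blast
qed

text \<open>Once the edge orbit is fixed by \<open>t = d / c = R / Q\<close>, the vertex orbits must
  have moments \<open>\<alpha>, \<beta>, g, h\<close>. Here \<open>\<gamma> = Q * g\<close> and
  \<open>\<delta> = Q^2 * h\<close> clear the denominators, so that the conditions are polynomial in
  the coordinates.\<close>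

lemma quintic_parameters_exist:
  fixes A B Q G R H E N M :: "'K::alg_closed_field"
  defines "\<alpha> \<equiv> A - (N - 16) * Q" and "\<beta> \<equiv> B - Q - (N - 8) * R"
    and "\<gamma> \<equiv> Q * G - 2 * Q * R - (N - 4) * R\<^sup>2"
    and "\<delta> \<equiv> Q\<^sup>2 * H - 3 * Q * R\<^sup>2 - (N - 2) * R ^ 3"
  assumes Q: "Q \<noteq> 0" and m: "\<alpha> * \<gamma> - Q * \<beta>\<^sup>2 \<noteq> 0"
    and disc: "(\<alpha> * \<delta> - Q * \<beta> * \<gamma>)\<^sup>2 - 4 * Q * (\<alpha> * \<gamma> - Q * \<beta>\<^sup>2) * (\<beta> * \<delta> - \<gamma>\<^sup>2) \<noteq> 0"
  shows "\<exists>a b a' b' c d e. A = a ^ 5 + a' ^ 5 + (N - 16) * c ^ 5 \<and>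
    B = a ^ 4 * b + a' ^ 4 * b' + c ^ 5 + (N - 8) * c ^ 4 * d \<and>
    Q = c ^ 5 \<and>
    G = a ^ 3 * b\<^sup>2 + a' ^ 3 * b'\<^sup>2 + 2 * c ^ 4 * d + (N - 4) * c ^ 3 * d\<^sup>2 \<and>
    R = c ^ 4 * d \<and>
    H = a\<^sup>2 * b ^ 3 + a'\<^sup>2 * b' ^ 3 + 3 * c ^ 3 * d\<^sup>2 + (N - 2) * c\<^sup>2 * d ^ 3 \<and>
    E = N * b ^ 5 + 5 * a * b ^ 4 + N * b' ^ 5 + 5 * a' * b' ^ 4
      + 10 * c\<^sup>2 * d ^ 3 + 5 * (N - 1) * c * d ^ 4 + M * d ^ 5 + e ^ 5"
proof -
  define t where "t = R / Q"
  have R: "R = Q * t" using Q by (simp add: t_def)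
  define g where "g = G - 2 * Q * t - (N - 4) * Q * t\<^sup>2"
  define h where "h = H - 3 * Q * t\<^sup>2 - (N - 2) * Q * t ^ 3"
  have g: "\<gamma> = Q * g"
    unfolding \<gamma>_def g_def R by algebra
  have h: "\<delta> = Q\<^sup>2 * h"
    unfolding \<delta>_def h_def R by algebra
  have "\<alpha> * \<gamma> - Q * \<beta>\<^sup>2 = Q * (\<alpha> * g - \<beta>\<^sup>2)" unfolding g by algebra
  then have "\<alpha> * g - \<beta>\<^sup>2 \<noteq> 0" using m by auto
  moreover have "(\<alpha> * \<delta> - Q * \<beta> * \<gamma>)\<^sup>2 - 4 * Q * (\<alpha> * \<gamma> - Q * \<beta>\<^sup>2) * (\<beta> * \<delta> - \<gamma>\<^sup>2)
    = Q ^ 4 * ((\<alpha> * h - \<beta> * g)\<^sup>2 - 4 * (\<alpha> * g - \<beta>\<^sup>2) * (\<beta> * h - g\<^sup>2))"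
    unfolding g h by algebra
  then have "(\<alpha> * h - \<beta> * g)\<^sup>2 - 4 * (\<alpha> * g - \<beta>\<^sup>2) * (\<beta> * h - g\<^sup>2) \<noteq> 0" using disc by auto
  ultimately obtain w s w' s' where ws: "w + w' = \<alpha>" "w * s + w' * s' = \<beta>"
    "w * s\<^sup>2 + w' * s'\<^sup>2 = g" "w * s ^ 3 + w' * s' ^ 3 = h"
    using sylvester_two_nodes by metis
  obtain a where a: "a ^ 5 = w" using nth_root_exists[of 5 w] by auto
  obtain a' where a': "a' ^ 5 = w'" using nth_root_exists[of 5 w'] by auto
  obtain c where c: "c ^ 5 = Q" using nth_root_exists[of 5 Q] by auto
  \<comment> \<open>Multiplying rather than dividing keeps the orbit equations valid even if a
    weight is zero.\<close>
  define b where "b = s * a"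
  define b' where "b' = s' * a'"
  define d where "d = t * c"
  obtain e where e: "e ^ 5 = E - (N * b ^ 5 + 5 * a * b ^ 4 + N * b' ^ 5 + 5 * a' * b' ^ 4
      + 10 * c\<^sup>2 * d ^ 3 + 5 * (N - 1) * c * d ^ 4 + M * d ^ 5)"
    using nth_root_exists[of 5] by auto
  have orbit: "x ^ 4 * (z * x) = x ^ 5 * z" "x ^ 3 * (z * x)\<^sup>2 = x ^ 5 * z\<^sup>2"
    "x\<^sup>2 * (z * x) ^ 3 = x ^ 5 * z ^ 3" for x z :: 'K
    by (simp_all add: power_numeral_reduce algebra_simps)
  have "A = a ^ 5 + a' ^ 5 + (N - 16) * c ^ 5" "Q = c ^ 5"
    using ws(1) by (simp_all add: a a' c \<alpha>_def algebra_simps)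
  moreover have "R = c ^ 4 * d"
    by (simp add: R d_def orbit c)
  moreover have "B = a ^ 4 * b + a' ^ 4 * b' + c ^ 5 + (N - 8) * c ^ 4 * d"
    using ws(2) by (simp add: b_def b'_def d_def orbit a a' c \<beta>_def R mult.assoc)
  moreover have "G = a ^ 3 * b\<^sup>2 + a' ^ 3 * b'\<^sup>2 + 2 * c ^ 4 * d + (N - 4) * c ^ 3 * d\<^sup>2"
    using ws(3) by (simp add: b_def b'_def d_def orbit a a' c g_def mult.assoc)
  moreover have "H = a\<^sup>2 * b ^ 3 + a'\<^sup>2 * b' ^ 3 + 3 * c ^ 3 * d\<^sup>2 + (N - 2) * c\<^sup>2 * d ^ 3"
    using ws(4) by (simp add: b_def b'_def d_def orbit a a' c h_def mult.assoc)
  moreover have "E = N * b ^ 5 + 5 * a * b ^ 4 + N * b' ^ 5 + 5 * a' * b' ^ 4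
      + 10 * c\<^sup>2 * d ^ 3 + 5 * (N - 1) * c * d ^ 4 + M * d ^ 5 + e ^ 5"
    unfolding e by simp
  ultimately show ?thesis
    by blast
qed

section \<open>Generic ranks\<close>

text \<open>The count is \<open>n\<close> vertices, \<open>n choose 2\<close> edges and one multiple
  of \<open>p_1\<close>.\<close>

lemma quartic_waring_rank_le:
  fixes g :: "nat list \<Rightarrow> 'K::alg_closed_field"
  assumes g: "quartic_type n g A B C D E"
    and nz: "C \<noteq> 0" "A - (of_nat n - 8) * C \<noteq> 0"
      "(of_nat n - 4)\<^sup>2 * C + (of_nat n - 2) * (A - (of_nat n - 8) * C) \<noteq> 0"
  shows "waring_rank n 4 (tensor_form n 4 g) \<le> enat (((n + 1) choose 2) + 1)"
proof -
  obtain a b c d e where eqs: "A = a ^ 4 + (of_nat n - 8) * c ^ 4"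
    "B = a ^ 3 * b + c ^ 4 + (of_nat n - 4) * c ^ 3 * d"
    "C = c ^ 4"
    "D = a\<^sup>2 * b\<^sup>2 + 2 * c ^ 3 * d + (of_nat n - 2) * c\<^sup>2 * d\<^sup>2"
    "E = of_nat n * b ^ 4 + 4 * a * b ^ 3 + 6 * c\<^sup>2 * d\<^sup>2 + 4 * (of_nat n - 1) * c * d ^ 3
      + of_nat (n choose 2) * d ^ 4 + e ^ 4"
    using quartic_parameters_exist[OF nz, of B D E "of_nat (n choose 2)"] by blast
  let ?h = "\<lambda>xs. vertex_tensor n a (\<lambda>_. b) xs + edge_tensor n c d xs + prod_list (map (\<lambda>_. e) xs)"
  have "quartic_type n ?h A B C D E"
    unfolding eqs by (rule quartic_type_orbits)
  then have "tensor_form n 4 g = tensor_form n 4 ?h"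
    by (intro tensor_form_cong quartic_type_unique[OF g])
  also have "\<dots> = (\<Sum>r\<in>{1..n}. linear_form n (\<lambda>x. a * of_bool (x = r) + b) ^ 4)
      + (\<Sum>S\<in>edges n. linear_form n (\<lambda>x. c * of_bool (x \<in> S) + d) ^ 4)
      + linear_form n (\<lambda>_. e) ^ 4"
    by (simp only: tensor_form_add tensor_form_vertex tensor_form_edge linear_form_power)
  \<comment> \<open>The three groups of powers are merged over a disjoint union, whose cardinality
    is the bound.\<close>
  also have "\<dots> = (\<Sum>j\<in>({1..n} <+> edges n) <+> {()}. (case j of
      Inl (Inl r) \<Rightarrow> linear_form n (\<lambda>x. a * of_bool (x = r) + b)
    | Inl (Inr S) \<Rightarrow> linear_form n (\<lambda>x. c * of_bool (x \<in> S) + d)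
    | Inr u \<Rightarrow> linear_form n (\<lambda>_. e)) ^ 4)"
    by (simp add: sum.Plus)
  finally have "waring_rank n 4 (tensor_form n 4 g) \<le> enat (card (({1..n} <+> edges n) <+> {()}))"
    by (rule waring_rank_sum_le[rotated 2])
      (auto simp: linear_form_in_forms simp del: One_nat_def split: sum.split)
  also have "card (({1..n} <+> edges n) <+> {()}) = ((n + 1) choose 2) + 1"
    by (simp add: card_Plus card_edges numeral_2_eq_2)
  finally show ?thesis .
qed

text \<open>The second vertex orbit raises the count to
  \<open>2 * n + (n choose 2) + 1\<close>.\<close>

lemma quintic_waring_rank_le:
  fixes g :: "nat list \<Rightarrow> 'K::alg_closed_field"
  assumes g: "quintic_type n g A B Q G R H E"
  defines "\<alpha> \<equiv> A - (of_nat n - 16) * Q" and "\<beta> \<equiv> B - Q - (of_nat n - 8) * R"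
    and "\<gamma> \<equiv> Q * G - 2 * Q * R - (of_nat n - 4) * R\<^sup>2"
    and "\<delta> \<equiv> Q\<^sup>2 * H - 3 * Q * R\<^sup>2 - (of_nat n - 2) * R ^ 3"
  assumes nz: "Q \<noteq> 0" "\<alpha> * \<gamma> - Q * \<beta>\<^sup>2 \<noteq> 0"
    "(\<alpha> * \<delta> - Q * \<beta> * \<gamma>)\<^sup>2 - 4 * Q * (\<alpha> * \<gamma> - Q * \<beta>\<^sup>2) * (\<beta> * \<delta> - \<gamma>\<^sup>2) \<noteq> 0"
  shows "waring_rank n 5 (tensor_form n 5 g) \<le> enat ((n + 2) choose 2)"
proof -
  obtain a b a' b' c d e where eqs: "A = a ^ 5 + a' ^ 5 + (of_nat n - 16) * c ^ 5"
    "B = a ^ 4 * b + a' ^ 4 * b' + c ^ 5 + (of_nat n - 8) * c ^ 4 * d"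
    "Q = c ^ 5"
    "G = a ^ 3 * b\<^sup>2 + a' ^ 3 * b'\<^sup>2 + 2 * c ^ 4 * d + (of_nat n - 4) * c ^ 3 * d\<^sup>2"
    "R = c ^ 4 * d"
    "H = a\<^sup>2 * b ^ 3 + a'\<^sup>2 * b' ^ 3 + 3 * c ^ 3 * d\<^sup>2 + (of_nat n - 2) * c\<^sup>2 * d ^ 3"
    "E = of_nat n * b ^ 5 + 5 * a * b ^ 4 + of_nat n * b' ^ 5 + 5 * a' * b' ^ 4
      + 10 * c\<^sup>2 * d ^ 3 + 5 * (of_nat n - 1) * c * d ^ 4 + of_nat (n choose 2) * d ^ 5 + e ^ 5"
    using quintic_parameters_exist[OF nz[unfolded \<alpha>_def \<beta>_def \<gamma>_def \<delta>_def], of E "of_nat (n choose 2)"]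
    by blast
  let ?h = "\<lambda>xs. vertex_tensor n a (\<lambda>_. b) xs + vertex_tensor n a' (\<lambda>_. b') xs
    + edge_tensor n c d xs + prod_list (map (\<lambda>_. e) xs)"
  have "quintic_type n ?h A B Q G R H E"
    unfolding eqs by (rule quintic_type_orbits)
  then have "tensor_form n 5 g = tensor_form n 5 ?h"
    by (intro tensor_form_cong quintic_type_unique[OF g])
  also have "\<dots> = (\<Sum>r\<in>{1..n}. linear_form n (\<lambda>x. a * of_bool (x = r) + b) ^ 5)
      + (\<Sum>r\<in>{1..n}. linear_form n (\<lambda>x. a' * of_bool (x = r) + b') ^ 5)
      + (\<Sum>S\<in>edges n. linear_form n (\<lambda>x. c * of_bool (x \<in> S) + d) ^ 5)
      + linear_form n (\<lambda>_. e) ^ 5"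
    by (simp only: tensor_form_add tensor_form_vertex tensor_form_edge linear_form_power)
  also have "\<dots> = (\<Sum>j\<in>({1..n} <+> {1..n}) <+> (edges n <+> {()}). (case j of
      Inl (Inl r) \<Rightarrow> linear_form n (\<lambda>x. a * of_bool (x = r) + b)
    | Inl (Inr r) \<Rightarrow> linear_form n (\<lambda>x. a' * of_bool (x = r) + b')
    | Inr (Inl S) \<Rightarrow> linear_form n (\<lambda>x. c * of_bool (x \<in> S) + d)
    | Inr (Inr u) \<Rightarrow> linear_form n (\<lambda>_. e)) ^ 5)"
    by (simp add: sum.Plus add.assoc)
  finally have "waring_rank n 5 (tensor_form n 5 g)
    \<le> enat (card (({1..n} <+> {1..n}) <+> (edges n <+> {()})))"
    by (rule waring_rank_sum_le[rotated 2])
      (auto simp: linear_form_in_forms simp del: One_nat_def split: sum.split)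
  also have "card (({1..n} <+> {1..n}) <+> (edges n <+> {()})) = (n + 2) choose 2"
    by (simp add: card_Plus card_edges numeral_2_eq_2)
  finally show ?thesis .
qed

section \<open>Base change to the algebraically closed field\<close>

lemma mset_invariant_comp: "mset_invariant g \<Longrightarrow> mset_invariant (\<lambda>xs. f (g xs))"
  unfolding mset_invariant_def by metis

context
  fixes \<iota> :: "'k::field_char_0 \<Rightarrow> 'K::field"
  assumes emb: "field_embedding \<iota>"
begin

lemma embedding_add: "\<iota> (x + y) = \<iota> x + \<iota> y"
  and embedding_mult: "\<iota> (x * y) = \<iota> x * \<iota> y"
  and embedding_1: "\<iota> 1 = 1"
  using emb by (auto simp: field_embedding_def)

lemma embedding_0: "\<iota> 0 = 0"
  by (metis add_cancel_right_right embedding_add)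

lemma embedding_diff: "\<iota> (x - y) = \<iota> x - \<iota> y"
  using embedding_add[of "x - y" y] by (simp add: eq_diff_eq)

lemma embedding_power: "\<iota> (x ^ k) = \<iota> x ^ k"
  by (induction k) (simp_all add: embedding_1 embedding_mult)

lemma embedding_of_nat: "\<iota> (of_nat k) = of_nat k"
  by (induction k) (simp_all add: embedding_0 embedding_1 embedding_add)

lemma embedding_numeral: "\<iota> (numeral k) = numeral k"
  using embedding_of_nat[of "numeral k"] by simp

text \<open>A nonzero element is a unit and stays one. This transfers the nonvanishing conditions
  from \<open>'k\<close> to \<open>'K\<close>.\<close>

lemma embedding_eq_0_iff: "\<iota> x = 0 \<longleftrightarrow> x = 0"
proof
  assume "\<iota> x = 0"
  then have "\<iota> (x * inverse x) = 0"
    by (simp add: embedding_mult)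
  then show "x = 0"
    by (metis embedding_1 right_inverse zero_neq_one)
qed (simp add: embedding_0)

lemmas embedding_simps = embedding_add embedding_mult embedding_1 embedding_0 embedding_diff
  embedding_power embedding_of_nat embedding_numeral

text \<open>The pattern values are integer combinations of the parameters, hence compatible with
  \<open>\<iota>\<close>.\<close>

lemma quartic_type_embedding:
  "quartic_type n g A B C D E \<Longrightarrow>
    quartic_type n (\<lambda>xs. \<iota> (g xs)) (\<iota> A) (\<iota> B) (\<iota> C) (\<iota> D) (\<iota> E)"
  unfolding quartic_type_def by (simp add: embedding_simps mset_invariant_comp)

lemma quintic_type_embedding:
  "quintic_type n g A B Q G R H E \<Longrightarrow>
    quintic_type n (\<lambda>xs. \<iota> (g xs)) (\<iota> A) (\<iota> B) (\<iota> Q) (\<iota> G) (\<iota> R) (\<iota> H) (\<iota> E)"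
  unfolding quintic_type_def by (simp add: embedding_simps mset_invariant_comp)

end

lemma extend_scalars_symmetric_form:
  assumes "field_embedding \<iota>" "F \<in> symmetric_forms n m"
  shows "extend_scalars \<iota> F = tensor_form n m (\<lambda>xs. \<iota> (form_tensor F xs))"
proof -
  have "F = tensor_form n m (form_tensor F)"
    using tensor_form_form_tensor[of F n m] assms(2) by (simp add: symmetric_forms_def)
  then show ?thesis
    using extend_scalars_tensor_form[OF embedding_0[OF assms(1)] embedding_add[OF assms(1)],
        of n m "form_tensor F"] by simp
qed

section \<open>Base points and the generic bounds\<close>

text \<open>The base point is \<open>\<Sum> X\<^sub>i\<^sup>4 + \<Sum> (X\<^sub>i + X\<^sub>j)\<^sup>4\<close>, which supplies the fallback values.\<close>

lemma generic_symmetric_quartic: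
  fixes \<iota> :: "'k::field_char_0 \<Rightarrow> 'K::alg_closed_field"
  assumes emb: "field_embedding \<iota>"
  shows "generic_in (symmetric_forms n 4 :: (nat, 'k) mpoly set)
    (\<lambda>F. waring_rank n 4 (extend_scalars \<iota> F) \<le> enat (((n + 1) choose 2) + 1))"
proof -
  define E :: "(nat monomial \<Rightarrow> 'k) \<Rightarrow> 'k" where "E x = word_coeff n [1, 2, 3, 4] 0 x" for x
  define D where "D x = word_coeff n [1, 1, 2, 3] 0 x - E x" for x
  define C where "C x = word_coeff n [1, 1, 2, 2] 1 x - 2 * D x - E x" for x
  define B where "B x = word_coeff n [1, 1, 1, 2] 1 x - 3 * D x - E x" for x
  define A where "A x = word_coeff n [1, 1, 1, 1] (of_nat n) x - 4 * B x - 3 * C x - 6 * D x - E x" for x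
  define W where "W x = A x - (of_nat n - 8) * C x" for x
  \<comment> \<open>The factors are the three nonvanishing hypotheses of
    \<open>quartic_waring_rank_le\<close>.\<close>
  define f where "f x = C x * W x * ((of_nat n - 4)\<^sup>2 * C x + (of_nat n - 2) * W x)" for x
  note coords = E_def D_def C_def B_def A_def
  define g :: "nat list \<Rightarrow> 'k" where
    "g = (\<lambda>xs. vertex_tensor n 1 (\<lambda>_. 0) xs + edge_tensor n 1 0 xs + prod_list (map (\<lambda>_. 0) xs))"
  have g: "quartic_type n g (of_nat n - 7) 1 1 0 0"
    using quartic_type_orbits[of n 1 0 1 0 0] by (simp add: g_def algebra_simps)
  let ?x = "Poly_Mapping.lookup (tensor_form n 4 g)"
  show ?thesis
  proof (rule generic_inI[of f])
    show "polynomial_fun f"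
      unfolding f_def W_def coords by (intro polynomial_intros)
    show "tensor_form n 4 g \<in> symmetric_forms n 4"
      by (rule tensor_form_quartic_symmetric[OF g])
    have inv: "mset_invariant g"
      using g by (simp add: quartic_type_def)
    have "word_coeff n [1, 2, 3, 4] 0 ?x = 0" "word_coeff n [1, 1, 2, 3] 0 ?x = 0"
      "word_coeff n [1, 1, 2, 2] 1 ?x = 1" "word_coeff n [1, 1, 1, 2] 1 ?x = 1"
      "word_coeff n [1, 1, 1, 1] (of_nat n) ?x = of_nat n"
      by (rule word_coeff_tensor_form[OF inv]; use g in \<open>simp add: quartic_type_def\<close>)+
    then have "C ?x = 1" "W ?x = 1"
      by (simp_all add: W_def coords)
    moreover have "(of_nat n - 4)\<^sup>2 + (of_nat n - 2) \<noteq> (0 :: 'k)"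
    proof -
      \<comment> \<open>Four times the left side is \<open>(2 * n - 7)^2 + 7\<close>, which is
        positive over the integers; characteristic 0 carries the inequality to
        \<open>'k\<close>.\<close>
      have "(int n - 4)\<^sup>2 + (int n - 2) \<noteq> 0"
      proof
        assume "(int n - 4)\<^sup>2 + (int n - 2) = 0"
        then have "(2 * int n - 7)\<^sup>2 + 7 = 0" by algebra
        then show False using zero_le_power2[of "2 * int n - 7"] by linarith
      qed
      then have "of_int ((int n - 4)\<^sup>2 + (int n - 2)) \<noteq> (0 :: 'k)"
        using of_int_eq_0_iff by blast
      then show ?thesis by (simp del: of_int_eq_0_iff)
    qed
    ultimately show "f ?x \<noteq> 0"
      by (simp add: f_def)
  next
    fix F :: "(nat, 'k) mpoly"
    let ?y = "Poly_Mapping.lookup F"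
    assume F: "F \<in> symmetric_forms n 4" and nz: "f ?y \<noteq> 0"
    have "quartic_type n (form_tensor F) (A ?y) (B ?y) (C ?y) (D ?y) (E ?y)"
      by (rule quartic_type_form_tensor[OF F]) (simp_all add: coords)
    from quartic_type_embedding[OF emb this]
    show "waring_rank n 4 (extend_scalars \<iota> F) \<le> enat (((n + 1) choose 2) + 1)"
      unfolding extend_scalars_symmetric_form[OF emb F]
    proof (rule quartic_waring_rank_le)
      have "\<iota> (C ?y) \<noteq> 0" "\<iota> (W ?y) \<noteq> 0"
        "\<iota> ((of_nat n - 4)\<^sup>2 * C ?y + (of_nat n - 2) * W ?y) \<noteq> 0"
        using nz by (simp_all add: f_def embedding_eq_0_iff[OF emb])
      then show "\<iota> (C ?y) \<noteq> 0" "\<iota> (A ?y) - (of_nat n - 8) * \<iota> (C ?y) \<noteq> 0"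
        "(of_nat n - 4)\<^sup>2 * \<iota> (C ?y) + (of_nat n - 2) * (\<iota> (A ?y) - (of_nat n - 8) * \<iota> (C ?y)) \<noteq> 0"
        by (simp_all add: W_def embedding_simps[OF emb])
    qed
  qed
qed

text \<open>The base point is \<open>\<Sum> (X\<^sub>i + p)\<^sup>5 + \<Sum> (X\<^sub>i - p)\<^sup>5 + \<Sum> (X\<^sub>i + X\<^sub>j)\<^sup>5\<close> with \<open>p = \<Sum> X\<^sub>i\<close>.\<close>

lemma generic_symmetric_quintic:
  fixes \<iota> :: "'k::field_char_0 \<Rightarrow> 'K::alg_closed_field"
  assumes emb: "field_embedding \<iota>"
  shows "generic_in (symmetric_forms n 5 :: (nat, 'k) mpoly set)
    (\<lambda>F. waring_rank n 5 (extend_scalars \<iota> F) \<le> enat ((n + 2) choose 2))"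
proof -
  \<comment> \<open>The fallbacks 10, 10, 10, 12, 13, 19 and \<open>n + 31\<close> are the pattern
    values of type \<open>(n - 14, 1, 1, 2, 0, 0, 10)\<close>, found for the base point
    below.\<close>
  define E :: "(nat monomial \<Rightarrow> 'k) \<Rightarrow> 'k" where "E x = word_coeff n [1, 2, 3, 4, 5] 10 x" for x
  define H where "H x = word_coeff n [1, 1, 2, 3, 4] 10 x - E x" for x
  define R where "R x = word_coeff n [1, 1, 2, 2, 3] 10 x - 2 * H x - E x" for x
  define G where "G x = word_coeff n [1, 1, 1, 2, 3] 12 x - 3 * H x - E x" for x
  define Q where "Q x = word_coeff n [1, 1, 1, 2, 2] 13 x - G x - 3 * R x - 4 * H x - E x" for x
  define B where "B x = word_coeff n [1, 1, 1, 1, 2] 19 x - 4 * G x - 3 * R x - 6 * H x - E x" for x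
  define A where "A x = word_coeff n [1, 1, 1, 1, 1] (of_nat n + 31) x
    - 5 * B x - 10 * Q x - 10 * G x - 15 * R x - 10 * H x - E x" for x
  define \<alpha> where "\<alpha> x = A x - (of_nat n - 16) * Q x" for x
  define \<beta> where "\<beta> x = B x - Q x - (of_nat n - 8) * R x" for x
  define \<gamma> where "\<gamma> x = Q x * G x - 2 * Q x * R x - (of_nat n - 4) * (R x)\<^sup>2" for x
  define \<delta> where "\<delta> x = (Q x)\<^sup>2 * H x - 3 * Q x * (R x)\<^sup>2 - (of_nat n - 2) * R x ^ 3" for x
  define \<mu> where "\<mu> x = \<alpha> x * \<gamma> x - Q x * (\<beta> x)\<^sup>2" for x
  define \<kappa> where "\<kappa> x = (\<alpha> x * \<delta> x - Q x * \<beta> x * \<gamma> x)\<^sup>2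
    - 4 * Q x * (\<alpha> x * \<gamma> x - Q x * (\<beta> x)\<^sup>2) * (\<beta> x * \<delta> x - (\<gamma> x)\<^sup>2)" for x
  define f where "f x = Q x * \<mu> x * \<kappa> x" for x
  note coords = E_def H_def R_def G_def Q_def B_def A_def
  note derived = \<mu>_def \<kappa>_def \<alpha>_def \<beta>_def \<gamma>_def \<delta>_def
  define g :: "nat list \<Rightarrow> 'k" where
    "g = (\<lambda>xs. vertex_tensor n 1 (\<lambda>_. 1) xs + vertex_tensor n 1 (\<lambda>_. - 1) xs
      + edge_tensor n 1 0 xs + prod_list (map (\<lambda>_. 0) xs))"
  have g: "quintic_type n g (of_nat n - 14) 1 1 2 0 0 10"
    using quintic_type_orbits[of n 1 1 1 "- 1" 1 0 0] by (simp add: g_def algebra_simps)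
  let ?x = "Poly_Mapping.lookup (tensor_form n 5 g)"
  show ?thesis
  proof (rule generic_inI[of f])
    have Q: "polynomial_fun Q" and R: "polynomial_fun R" and G: "polynomial_fun G"
      and H: "polynomial_fun H" and B: "polynomial_fun B" and A: "polynomial_fun A"
      unfolding coords by (intro polynomial_intros)+
    have "polynomial_fun \<alpha>" "polynomial_fun \<beta>" "polynomial_fun \<gamma>" "polynomial_fun \<delta>"
      unfolding \<alpha>_def \<beta>_def \<gamma>_def \<delta>_def by (intro polynomial_intros Q R G H B A)+
    with Q show "polynomial_fun f"
      unfolding f_def \<mu>_def \<kappa>_def by (intro polynomial_intros)
    show "tensor_form n 5 g \<in> symmetric_forms n 5"
      by (rule tensor_form_quintic_symmetric[OF g])
    have inv: "mset_invariant g"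
      using g by (simp add: quintic_type_def)
    have "word_coeff n [1, 2, 3, 4, 5] 10 ?x = 10" "word_coeff n [1, 1, 2, 3, 4] 10 ?x = 10"
      "word_coeff n [1, 1, 2, 2, 3] 10 ?x = 10" "word_coeff n [1, 1, 1, 2, 3] 12 ?x = 12"
      "word_coeff n [1, 1, 1, 2, 2] 13 ?x = 13" "word_coeff n [1, 1, 1, 1, 2] 19 ?x = 19"
      "word_coeff n [1, 1, 1, 1, 1] (of_nat n + 31) ?x = of_nat n + 31"
      by (rule word_coeff_tensor_form[OF inv]; use g in \<open>simp add: quintic_type_def\<close>)+
    then have "Q ?x = 1" "R ?x = 0" "G ?x = 2" "H ?x = 0" "B ?x = 1" "A ?x = of_nat n - 14"
      by (simp_all add: coords)
    \<comment> \<open>The opposite nodes 1 and -1 cancel the odd moments. Hence \<open>\<mu>\<close>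
      is 4 and \<open>\<kappa>\<close> is 64 at the base point, for every \<open>n\<close>.\<close>
    then have "Q ?x = 1" "\<alpha> ?x = 2" "\<beta> ?x = 0" "\<gamma> ?x = 2" "\<delta> ?x = 0"
      by (simp_all add: \<alpha>_def \<beta>_def \<gamma>_def \<delta>_def)
    then show "f ?x \<noteq> 0"
      by (simp add: f_def \<mu>_def \<kappa>_def)
  next
    fix F :: "(nat, 'k) mpoly"
    let ?y = "Poly_Mapping.lookup F"
    assume F: "F \<in> symmetric_forms n 5" and nz: "f ?y \<noteq> 0"
    have "quintic_type n (form_tensor F) (A ?y) (B ?y) (Q ?y) (G ?y) (R ?y) (H ?y) (E ?y)"
      by (rule quintic_type_form_tensor[OF F]) (simp_all add: coords)
    note type = quintic_type_embedding[OF emb this]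
    have nz': "\<iota> (Q ?y) \<noteq> 0" "\<iota> (\<mu> ?y) \<noteq> 0" "\<iota> (\<kappa> ?y) \<noteq> 0"
      using nz by (simp_all add: f_def embedding_eq_0_iff[OF emb])
    show "waring_rank n 5 (extend_scalars \<iota> F) \<le> enat ((n + 2) choose 2)"
      unfolding extend_scalars_symmetric_form[OF emb F]
      by (rule quintic_waring_rank_le[OF type nz'[unfolded derived embedding_simps[OF emb]]])
  qed
qed

theorem proposition5p1:
  fixes \<iota> :: "'k::field_char_0 \<Rightarrow> 'K::alg_closed_field"
    and n :: nat
  assumes "field_embedding \<iota>"
  shows "generic_in (symmetric_forms n 4 :: (nat, 'k) mpoly set)
           (\<lambda>F. waring_rank n 4 (extend_scalars \<iota> F) \<le> enat (((n + 1) choose 2) + 1))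
       \<and> int (((n + 1) choose 2) + 1) = int ((n + 2) choose 2) - int n
       \<and> generic_in (symmetric_forms n 5 :: (nat, 'k) mpoly set)
           (\<lambda>F. waring_rank n 5 (extend_scalars \<iota> F) \<le> enat ((n + 2) choose 2))"
  \<comment> \<open>The remaining identity of binomials is Pascal's rule, available once 2 is
    written with \<open>Suc\<close>.\<close>
  using generic_symmetric_quartic[OF assms] generic_symmetric_quintic[OF assms]
  by (simp add: numeral_2_eq_2)

end
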